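(* For every deletion probability $q \in (0,1)$ and every $\delta > 0$ there exists $C > 0$ such that the following holds for every $n \ge 2$. Let $T = \exp(Cn^{1/5}\log^5 n)$. There is a function $F : \left(\bigcup_{j=0}^n \{0,1\}^j\right)^T \to \{0,1\}^n$ such that for every $x \in \{0,1\}^n$, if $U^1,\dots,U^T$ are i.i.d. traces of $x$ (with deletion probability $q$), then $\mathbb{P}[F(U^1,\dots,U^T) = x] \ge 1-\delta$.
   Context: Given $x \in \{0,1\}^n$ and $q \in (0,1)$, a trace of $x$ is the random string obtained by deleting each bit of $x$ independently with probability $q$ and concatenating the remaining bits (in order). Equivalently, the law $\mu_x$ of a trace on $\bigcup_{j=0}^n\{0,1\}^j$ is $\mu_x(w) = (1-q)^{|w|}q^{n-|w|}f(w;x)$, where $f(w;x)$ is the number of strictly increasing index tuples $(i_0,\dots,i_{|w|-1})$ with $x_{i_j}=w_j$ for all $j$. Floor functions are omitted (e.g. $T$ is implicitly rounded to an integer). $\log$ is the natural logarithm. *)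

theory Defs
  imports Complex_Main
begin

definition occ_count :: "bool list \<Rightarrow> bool list \<Rightarrow> nat" where
  "occ_count w x = card {is :: nat list. length is = length w \<and> sorted_wrt (<) is
       \<and> (\<forall>i\<in>set is. i < length x) \<and> (\<forall>j<length w. x ! (is ! j) = w ! j)}"

definition trace_law :: "real \<Rightarrow> bool list \<Rightarrow> bool list \<Rightarrow> real" where
  "trace_law q x w = (if length w \<le> length x
     then (1 - q) ^ length w * q ^ (length x - length w) * real (occ_count w x) else 0)"

definition words_upto :: "nat \<Rightarrow> bool list set" where
  "words_upto n = {w. length w \<le> n}"

definition tuples :: "nat \<Rightarrow> nat \<Rightarrow> bool list list set" where
  "tuples T n = {ws. length ws = T \<and> set ws \<subseteq> words_upto n}"

definition recon_prob :: "real \<Rightarrow> bool list \<Rightarrow> nat \<Rightarrow> (bool list list \<Rightarrow> bool list) \<Rightarrow> real" where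
  "recon_prob q x T F = (\<Sum>ws\<in>tuples T (length x).
      if F ws = x then (\<Prod>i<T. trace_law q x (ws ! i)) else 0)"

definition num_traces :: "real \<Rightarrow> nat \<Rightarrow> nat" where
  "num_traces C n = nat \<lfloor>exp (C * real n powr (1/5) * (ln (real n)) ^ 5)\<rfloor>"

end

theory Submission
  imports Defs "HOL-Complex_Analysis.Conformal_Mappings"
begin

text \<open>
  Let \<open>a \<approx> n\<^sup>1\<^sup>/\<^sup>5\<close>. It suffices to bound the total variation distance of the trace laws of two strings
  \<open>x \<noteq> y\<close> from below by \<open>exp (- C a log\<^sup>3 a)\<close>; maximum likelihood estimation then recovers \<open>x\<close>.

  For a word \<open>w\<close> of length \<open>2 a + 1\<close>, the expected value over traces of the generating function of
  the embeddings of \<open>w\<close> is, up to a factor and an affine change of variables, the same generating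
  function for \<open>x\<close>. It has a variable \<open>u\<close> for the position of the first letter and a variable \<open>z\<close> for
  the gaps, so that \<open>z = 0\<close> selects the contiguous occurrences of \<open>w\<close> in \<open>x\<close>. Let \<open>w\<close> end at the first
  difference of \<open>x\<close> and \<open>y\<close>. One of the two choices of the last letter makes \<open>w\<close> free of periods
  \<open>\<le> a\<close>, so its occurrences are far apart, and the difference of the two generating functions at
  \<open>z = 0\<close> is, up to sign, \<open>u\<^sup>m P(u)\<close> with \<open>P(u) = 1 - \<eta> u\<^sup>d + u\<^sup>a Q(u)\<close> and \<open>Q\<close> having bounded coefficients.

  The map \<open>h(z) = 1 - (1 - z)\<^sup>\<beta>\<close> with \<open>\<beta> = 1 - 1 / log n\<close> sends the unit disc to a subdomain which
  leaves the unit circle linearly (up to a logarithm) in the distance to \<open>1\<close>. Hence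
  \<open>F = P(h) / (1 - \<eta> h\<^sup>d)\<close> is extremely close to \<open>1\<close> except near \<open>1\<close>. By the maximum principle the product
  of \<open>F\<close> over some rotation of the \<open>a\<^sup>2\<close>-th roots of unity is at least \<open>1\<close> in modulus; only about
  \<open>a log\<^sup>2 n\<close> of its factors can be large, so the one factor at distance \<open>O(a\<^sup>-\<^sup>2)\<close> from \<open>1\<close> cannot be
  too small. Two constants arguments transfer this lower bound to a point \<open>u\<close> of the unit circle at
  distance \<open>O(a\<^sup>-\<^sup>2)\<close> from \<open>1\<close>, and from \<open>z = 0\<close> to a \<open>z\<close> with \<open>\<bar>z - q\<bar> \<le> 1 - q\<close>. There the statistic of a
  trace is bounded by \<open>exp (O(a log n))\<close>, since \<open>n a\<^sup>-\<^sup>4 \<le> a\<close>.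
\<close>

section \<open>Trace laws and generating functions of embeddings\<close>

lemma occ_count_Nil [simp]: "occ_count [] x = 1"
proof -
  have "{is :: nat list. length is = length ([]::bool list) \<and> sorted_wrt (<) is
       \<and> (\<forall>i\<in>set is. i < length x) \<and> (\<forall>j<length ([]::bool list). x ! (is ! j) = [] ! j)} = {[]}"
    by auto
  then show ?thesis unfolding occ_count_def by simp
qed

lemma occ_count_Cons_Nil [simp]: "occ_count (b # w) [] = 0"
proof -
  have "{is :: nat list. length is = length (b # w) \<and> sorted_wrt (<) is
       \<and> (\<forall>i\<in>set is. i < length ([]::bool list)) \<and> (\<forall>j<length (b # w). [] ! (is ! j) = (b # w) ! j)} = {}"
    by (auto simp: length_Suc_conv)
  then show ?thesis unfolding occ_count_def by simp
qed

text \<open>Embeddings are split by their first index: those avoiding position 0 are shifts of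
  embeddings into \<open>x\<close>, those using it must match \<open>b\<close> with \<open>c\<close>
  there.\<close>

lemma occ_count_Cons_Cons [simp]:
  "occ_count (b # w) (c # x) = occ_count (b # w) x + (if b = c then occ_count w x else 0)"
proof -
  define S where "S w x = {is :: nat list. length is = length w \<and> sorted_wrt (<) is
       \<and> (\<forall>i\<in>set is. i < length x) \<and> (\<forall>j<length w. x ! (is ! j) = w ! j)}" for w x :: "bool list"
  have fin: "finite (S w x)" for w x
  proof (rule finite_subset)
    show "S w x \<subseteq> {is. set is \<subseteq> {..<length x} \<and> length is = length w}"
      by (auto simp: S_def)
  qed (simp add: finite_lists_length_eq)
  let ?A = "map Suc ` S (b # w) x" and ?B = "(\<lambda>is. 0 # map Suc is) ` S w x"
  have sub: "?A \<union> (if b = c then ?B else {}) \<subseteq> S (b # w) (c # x)"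
    by (auto simp: S_def sorted_wrt_map less_Suc_eq_0_disj)
  have sup: "S (b # w) (c # x) \<subseteq> ?A \<union> (if b = c then ?B else {})"
  proof
    fix js assume js: "js \<in> S (b # w) (c # x)"
    then obtain i js' where i: "js = i # js'" by (auto simp: S_def length_Suc_conv)
    have pos: "\<forall>k\<in>set js'. 0 < k" using js i by (auto simp: S_def)
    have eq: "js' = map Suc (map (\<lambda>k. k - 1) js')"
      using pos by (simp add: map_idI)
    show "js \<in> ?A \<union> (if b = c then ?B else {})"
    proof (cases i)
      case 0
      define ks where "ks = map (\<lambda>k. k - 1) js'"
      have "js = 0 # map Suc ks" using eq i 0 by (simp add: ks_def)
      moreover from this have "b = c" "ks \<in> S w x"
        using js by (auto simp: S_def sorted_wrt_map less_Suc_eq_0_disj All_less_Suc2)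
      ultimately show ?thesis by auto
    next
      case (Suc i')
      define ks where "ks = i' # map (\<lambda>k. k - 1) js'"
      have "js = map Suc ks" using eq i Suc by (simp add: ks_def)
      moreover from this have "ks \<in> S (b # w) x"
        using js by (auto simp: S_def sorted_wrt_map)
      ultimately show ?thesis by auto
    qed
  qed
  have "card (S (b # w) (c # x)) = card (?A \<union> (if b = c then ?B else {}))"
    using sub sup by (metis subset_antisym)
  also have "\<dots> = card ?A + card (if b = c then ?B else {})"
  proof (rule card_Un_disjoint)
    show "?A \<inter> (if b = c then ?B else {}) = {}" by (auto simp: Cons_eq_map_conv)
  qed (simp_all add: fin)
  also have "card ?A = card (S (b # w) x)"
    by (intro card_image) (auto simp: inj_on_def)
  also have "card (if b = c then ?B else {}) = (if b = c then card (S w x) else 0)"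
    by (auto intro!: card_image simp: inj_on_def)
  finally show ?thesis by (simp add: occ_count_def S_def)
qed

lemma occ_count_eq_0: "length x < length w \<Longrightarrow> occ_count w x = 0"
proof (induction x arbitrary: w)
  case Nil then show ?case by (cases w) auto
next
  case (Cons c x) then show ?case by (cases w) auto
qed

lemma trace_law_Cons_Nil: "trace_law q (c # x) [] = q * trace_law q x []"
  by (simp add: trace_law_def)

text \<open>Conditions on the fate of the letter \<open>c\<close>. The exponent of \<open>q\<close>
  is a truncated difference, whose recursion is valid only for \<open>length w < length x\<close>;
  in the other cases the counts of too long words vanish.\<close>

lemma trace_law_Cons_Cons:
  "trace_law q (c # x) (b # w) =
     q * trace_law q x (b # w) + (if b = c then (1 - q) * trace_law q x w else 0)"
proof -
  consider "length w < length x" | "length w = length x" | "length w > length x" by linarith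
  then show ?thesis
  proof cases
    case 1
    then have "length x - length w = Suc (length x - Suc (length w))" by simp
    then show ?thesis using 1 by (simp add: trace_law_def algebra_simps)
  qed (auto simp: trace_law_def occ_count_eq_0)
qed

lemma trace_law_nonneg: "0 \<le> q \<Longrightarrow> q \<le> 1 \<Longrightarrow> 0 \<le> trace_law q x w"
  by (simp add: trace_law_def)

lemma trace_law_eq_0: "length x < length w \<Longrightarrow> trace_law q x w = 0"
  by (simp add: trace_law_def)

lemma finite_words_upto [simp]: "finite (words_upto n)"
  using finite_lists_length_le[of "UNIV :: bool set" n] by (simp add: words_upto_def)

lemma words_upto_0: "words_upto 0 = {[]}"
  by (auto simp: words_upto_def)

lemma sum_words_upto_Suc:
  fixes g :: "bool list \<Rightarrow> 'a :: comm_monoid_add"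
  shows "sum g (words_upto (Suc n)) =
     g [] + (\<Sum>w\<in>words_upto n. g (True # w) + g (False # w))"
proof -
  have eq: "words_upto (Suc n) =
     insert [] ((#) True ` words_upto n \<union> (#) False ` words_upto n)"
  proof (intro equalityI subsetI)
    fix w assume "w \<in> words_upto (Suc n)"
    then show "w \<in> insert [] ((#) True ` words_upto n \<union> (#) False ` words_upto n)"
      by (cases w; cases "hd w") (auto simp: words_upto_def)
  qed (auto simp: words_upto_def)
  have "sum g (words_upto (Suc n)) =
     g [] + (sum g ((#) True ` words_upto n) + sum g ((#) False ` words_upto n))"
    unfolding eq by (subst sum.insert, force, force, subst sum.union_disjoint) auto
  then show ?thesis by (simp add: sum.reindex sum.distrib)
qed

section \<open>Expectations over traces\<close>

definition trace_mean :: "real \<Rightarrow> bool list \<Rightarrow> (bool list \<Rightarrow> complex) \<Rightarrow> complex" where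
  "trace_mean q x f = (\<Sum>w\<in>words_upto (length x). of_real (trace_law q x w) * f w)"

lemma trace_mean_Nil [simp]: "trace_mean q [] f = f []"
  by (simp add: trace_mean_def words_upto_0 trace_law_def)

lemma sum_words_upto_trace_law:
  assumes "length x \<le> n"
  shows "(\<Sum>w\<in>words_upto n. of_real (trace_law q x w) * f w) = trace_mean q x f"
  unfolding trace_mean_def using assms
  by (intro sum.mono_neutral_right finite_words_upto) (auto simp: words_upto_def trace_law_eq_0)

text \<open>The first letter is either deleted or kept. This recursion drives the later inductions
  over the string.\<close>

lemma trace_mean_Cons [simp]:
  "trace_mean q (c # x) f = q * trace_mean q x f + (1 - q) * trace_mean q x (\<lambda>w. f (c # w))"
proof -
  define n where "n = length x"
  have "trace_mean q (c # x) f = trace_law q (c # x) [] * f [] +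
     (\<Sum>w\<in>words_upto n. trace_law q (c # x) (True # w) * f (True # w) +
        trace_law q (c # x) (False # w) * f (False # w))"
    by (simp add: trace_mean_def sum_words_upto_Suc n_def)
  also have "\<dots> = q * (trace_law q x [] * f [] +
     (\<Sum>w\<in>words_upto n. trace_law q x (True # w) * f (True # w) +
        trace_law q x (False # w) * f (False # w))) +
     (1 - q) * (\<Sum>w\<in>words_upto n. trace_law q x w * f (c # w))"
    by (cases c) (simp_all add: trace_law_Cons_Nil trace_law_Cons_Cons algebra_simps
         sum.distrib sum_distrib_left sum_subtractf)
  also have "trace_law q x [] * f [] +
     (\<Sum>w\<in>words_upto n. trace_law q x (True # w) * f (True # w) +
        trace_law q x (False # w) * f (False # w)) = trace_mean q x f"
    using sum_words_upto_trace_law[of x "Suc n" q f] by (simp add: sum_words_upto_Suc n_def)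
  finally show ?thesis by (simp add: trace_mean_def n_def)
qed

lemma trace_mean_const [simp]: "trace_mean q x (\<lambda>_. k) = k"
  by (induction x) (simp_all add: algebra_simps)

lemma sum_trace_law: "(\<Sum>w\<in>words_upto (length x). trace_law q x w) = 1"
proof -
  have "complex_of_real (\<Sum>w\<in>words_upto (length x). trace_law q x w) = 1"
    using trace_mean_const[of q x 1] unfolding trace_mean_def by simp
  then show ?thesis by (simp only: of_real_eq_1_iff)
qed

lemma trace_mean_add: "trace_mean q x (\<lambda>w. f w + g w) = trace_mean q x f + trace_mean q x g"
  by (simp add: trace_mean_def sum.distrib algebra_simps)

lemma trace_mean_mult: "trace_mean q x (\<lambda>w. k * f w) = k * trace_mean q x f"
  by (simp add: trace_mean_def sum_distrib_left algebra_simps)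

text \<open>
  \<open>occ_gf u z w x\<close> is the sum of \<open>u ^ i\<^sub>0 * z ^ g\<close> over all embeddings \<open>i\<^sub>0 < i\<^sub>1 < \<dots>\<close> of \<open>w\<close> into \<open>x\<close>, where \<open>g\<close> is
  the number of skipped letters between the first and the last position; \<open>gap_gf\<close> is the part after
  the first letter, with the skipped letters in front counted by \<open>z\<close>. For empty \<open>w\<close> the value of
  \<open>occ_gf\<close> is \<open>0\<close>.
\<close>

fun gap_gf :: "complex \<Rightarrow> bool list \<Rightarrow> bool list \<Rightarrow> complex" where
  "gap_gf z [] x = 1"
| "gap_gf z (b # w) [] = 0"
| "gap_gf z (b # w) (c # x) = z * gap_gf z (b # w) x + (if b = c then gap_gf z w x else 0)"

fun occ_gf :: "complex \<Rightarrow> complex \<Rightarrow> bool list \<Rightarrow> bool list \<Rightarrow> complex" where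
  "occ_gf u z w [] = 0"
| "occ_gf u z w (c # x) = u * occ_gf u z w x + (if w \<noteq> [] \<and> hd w = c then gap_gf z (tl w) x else 0)"

text \<open>A matched letter must survive, hence the factor \<open>1 - q\<close>. A skipped letter
  is either deleted, or survives and is skipped again in the trace, so its weight becomes
  \<open>q + (1 - q) * z\<close>.\<close>

lemma trace_mean_gap_gf:
  "trace_mean q x (gap_gf z w) = (1 - q) ^ length w * gap_gf (q + (1 - q) * z) w x"
proof (induction x arbitrary: w)
  case Nil then show ?case by (cases w) simp_all
next
  case (Cons c x)
  show ?case
  proof (cases w)
    case Nil
    then have "gap_gf z w = (\<lambda>_. 1)" by auto
    then show ?thesis using Nil by (simp add: algebra_simps)
  next
    case (Cons b v)
    have "trace_mean q x (\<lambda>w'. gap_gf z w (c # w')) =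
       z * trace_mean q x (gap_gf z w) + (if b = c then trace_mean q x (gap_gf z v) else 0)"
      using Cons by (simp add: trace_mean_add trace_mean_mult)
    then have "trace_mean q (c # x) (gap_gf z w) = (q + (1 - q) * z) * trace_mean q x (gap_gf z w) +
       (1 - q) * (if b = c then trace_mean q x (gap_gf z v) else 0)"
      by (simp add: algebra_simps)
    then show ?thesis
      unfolding Cons.IH by (simp add: Cons distrib_left mult.assoc mult.left_commute)
  qed
qed

lemma trace_mean_occ_gf:
  "trace_mean q x (occ_gf u z w) =
     (1 - q) ^ length w * occ_gf (q + (1 - q) * u) (q + (1 - q) * z) w x"
proof (induction x)
  case Nil then show ?case by simp
next
  case (Cons c x)
  have "trace_mean q x (\<lambda>w'. occ_gf u z w (c # w')) =
     u * trace_mean q x (occ_gf u z w) +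
       (if w \<noteq> [] \<and> hd w = c then trace_mean q x (gap_gf z (tl w)) else 0)"
    by (simp add: trace_mean_add trace_mean_mult)
  then have "trace_mean q (c # x) (occ_gf u z w) = (q + (1 - q) * u) * trace_mean q x (occ_gf u z w) +
     (1 - q) * (if w \<noteq> [] \<and> hd w = c then trace_mean q x (gap_gf z (tl w)) else 0)"
    by (simp add: algebra_simps)
  then show ?case
    unfolding Cons trace_mean_gap_gf
    by (cases w) (simp_all add: distrib_left mult.assoc mult.left_commute)
qed

section \<open>Growth and holomorphy of the generating functions\<close>

lemma norm_gap_gf_le_power:
  assumes "cmod z \<le> 1"
  shows "cmod (gap_gf z w x) \<le> (real (length x) + 1) ^ length w"
  using assms
proof (induction z w x rule: gap_gf.induct)
  case (3 z b w c x)
  let ?n = "real (length x) + 1"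
  have "cmod (gap_gf z (b # w) (c # x)) \<le>
     cmod z * cmod (gap_gf z (b # w) x) + cmod (if b = c then gap_gf z w x else 0)"
    by (simp add: norm_triangle_ineq norm_mult[symmetric])
  also have "\<dots> \<le> 1 * ?n ^ length (b # w) + ?n ^ length w"
    using 3 by (intro add_mono mult_mono) auto
  also have "\<dots> = (?n + 1) * ?n ^ length w" by (simp add: algebra_simps)
  also have "\<dots> \<le> (?n + 1) * (?n + 1) ^ length w"
    by (intro mult_left_mono power_mono) auto
  finally show ?case by (simp add: algebra_simps)
qed auto

text \<open>Meant for traces, where \<open>z\<close> may have modulus 1 and \<open>u\<close> may lie
  slightly outside the unit disc: a power of the length pays for the number of embeddings, a power
  of \<open>B\<close> for the first position.\<close>

lemma norm_occ_gf_le_power: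
  assumes z: "cmod z \<le> 1" and B: "1 \<le> B" "cmod u \<le> B"
  shows "cmod (occ_gf u z w x) \<le> B ^ length x * (real (length x) + 1) ^ Suc (length w)"
proof (induction x)
  case (Cons c x)
  let ?n = "real (length x) + 1" and ?l = "length w"
  have gap: "cmod (gap_gf z (tl w) x) \<le> (?n + 1) ^ ?l"
  proof -
    have "cmod (gap_gf z (tl w) x) \<le> ?n ^ (?l - 1)"
      using norm_gap_gf_le_power[OF z, of "tl w" x] by simp
    also have "\<dots> \<le> (?n + 1) ^ (?l - 1)" by (intro power_mono) auto
    also have "\<dots> \<le> (?n + 1) ^ ?l" by (intro power_increasing) auto
    finally show ?thesis .
  qed
  have "cmod (occ_gf u z w (c # x)) \<le>
     cmod u * cmod (occ_gf u z w x) + cmod (if w \<noteq> [] \<and> hd w = c then gap_gf z (tl w) x else 0)"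
    by (simp add: norm_triangle_ineq norm_mult[symmetric])
  also have "\<dots> \<le> B * (B ^ length x * ?n ^ Suc ?l) + B ^ length (c # x) * (?n + 1) ^ ?l"
  proof (intro add_mono mult_mono)
    have "cmod (if w \<noteq> [] \<and> hd w = c then gap_gf z (tl w) x else 0) \<le> 1 * (?n + 1) ^ ?l"
      using gap by simp
    also have "\<dots> \<le> B ^ length (c # x) * (?n + 1) ^ ?l"
      using B by (intro mult_right_mono one_le_power) auto
    finally show "cmod (if w \<noteq> [] \<and> hd w = c then gap_gf z (tl w) x else 0) \<le>
       B ^ length (c # x) * (?n + 1) ^ ?l" .
  qed (use B Cons in auto)
  also have "\<dots> = B ^ length (c # x) * (?n * ?n ^ ?l + (?n + 1) ^ ?l)"
    by (simp add: algebra_simps)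
  also have "\<dots> \<le> B ^ length (c # x) * (?n * (?n + 1) ^ ?l + (?n + 1) ^ ?l)"
    using B by (intro mult_left_mono add_mono power_mono) auto
  finally show ?case by (simp add: algebra_simps)
qed auto

text \<open>
  For \<open>\<bar>z\<bar> < 1\<close> the gaps are summed as geometric series, so the bound is exponential in \<open>length w\<close> only.
\<close>

lemma norm_gap_gf_le_geometric:
  assumes "cmod z \<le> R" "R < 1"
  shows "cmod (gap_gf z w x) \<le> (1 / (1 - R)) ^ length w"
  using assms
proof (induction z w x rule: gap_gf.induct)
  case (3 z b w c x)
  let ?g = "1 / (1 - R)"
  have R: "0 \<le> R" using 3 norm_ge_zero[of z] by linarith
  have "cmod (gap_gf z (b # w) (c # x)) \<le>
     cmod z * cmod (gap_gf z (b # w) x) + cmod (if b = c then gap_gf z w x else 0)"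
    by (simp add: norm_triangle_ineq norm_mult[symmetric])
  also have "\<dots> \<le> R * ?g ^ length (b # w) + ?g ^ length w"
    using 3 R by (intro add_mono mult_mono) auto
  also have "\<dots> = (R * ?g + 1) * ?g ^ length w" by (simp add: algebra_simps)
  also have "R * ?g + 1 = ?g" using 3 by (simp add: field_simps)
  finally show ?case by simp
qed auto

lemma norm_occ_gf_le_geometric:
  assumes z: "cmod z \<le> R" "R < 1" and u: "cmod u \<le> 1"
  shows "cmod (occ_gf u z w x) \<le> real (length x) * (1 / (1 - R)) ^ length w"
proof (induction x)
  case (Cons c x)
  let ?g = "1 / (1 - R)"
  have R: "0 \<le> R" using z norm_ge_zero[of z] by linarith
  have gap: "cmod (gap_gf z (tl w) x) \<le> ?g ^ length w"
  proof -
    have "cmod (gap_gf z (tl w) x) \<le> ?g ^ (length w - 1)"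
      using norm_gap_gf_le_geometric[OF z, of "tl w" x] by simp
    also have "\<dots> \<le> ?g ^ length w" using R z by (intro power_increasing) auto
    finally show ?thesis .
  qed
  have "cmod (occ_gf u z w (c # x)) \<le>
     cmod u * cmod (occ_gf u z w x) + cmod (if w \<noteq> [] \<and> hd w = c then gap_gf z (tl w) x else 0)"
    by (simp add: norm_triangle_ineq norm_mult[symmetric])
  also have "\<dots> \<le> 1 * (length x * ?g ^ length w) + ?g ^ length w"
    using gap u Cons z by (intro add_mono mult_mono) auto
  finally show ?case by (simp add: algebra_simps)
qed auto

lemma holomorphic_gap_gf [holomorphic_intros]: "(\<lambda>z. gap_gf z w x) holomorphic_on S"
proof (induction x arbitrary: w)
  case Nil then show ?case by (cases w) simp_all
next
  case (Cons c x)
  show ?case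
  proof (cases w)
    case (Cons b v)
    have "(\<lambda>z. if b = c then gap_gf z v x else 0) holomorphic_on S"
      using Cons.IH[of v] by (cases "b = c") auto
    then show ?thesis using Cons Cons.IH[of w] by (auto intro!: holomorphic_intros)
  qed simp
qed

lemma holomorphic_occ_gf [holomorphic_intros]: "(\<lambda>z. occ_gf u z w x) holomorphic_on S"
proof (induction x)
  case (Cons c x)
  have "(\<lambda>z. if w \<noteq> [] \<and> hd w = c then gap_gf z (tl w) x else 0) holomorphic_on S"
    by (cases "w \<noteq> [] \<and> hd w = c") (auto intro!: holomorphic_intros)
  then show ?case using Cons by (auto intro!: holomorphic_intros)
qed simp

lemma gap_gf_0: "gap_gf 0 w x = (if take (length w) x = w then 1 else 0)"
  by (induction "0::complex" w x rule: gap_gf.induct) auto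

lemma occ_gf_0:
  "occ_gf u 0 (b # w) x = (\<Sum>k | k < length x \<and> take (Suc (length w)) (drop k x) = b # w. u ^ k)"
proof (induction x)
  case (Cons c x)
  let ?P = "\<lambda>x k. k < length x \<and> take (Suc (length w)) (drop k x) = b # w"
  have "{k. ?P (c # x) k} = (if ?P (c # x) 0 then {0} else {}) \<union> Suc ` {k. ?P x k}"
    (is "?L = ?R")
  proof (intro set_eqI)
    fix k show "k \<in> ?L \<longleftrightarrow> k \<in> ?R" by (cases k) auto
  qed
  then have "(\<Sum>k | ?P (c # x) k. u ^ k) =
     (if ?P (c # x) 0 then 1 else 0) + (\<Sum>k\<in>Suc ` {k. ?P x k}. u ^ k)"
    by (simp add: sum.union_disjoint)
  also have "(\<Sum>k\<in>Suc ` {k. ?P x k}. u ^ k) = u * (\<Sum>k | ?P x k. u ^ k)"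
    by (simp add: sum.reindex sum_distrib_left)
  finally show ?case using Cons by (auto simp: gap_gf_0)
qed auto

section \<open>Maximum likelihood reconstruction\<close>

lemma tuples_0: "tuples 0 n = {[]}"
  by (auto simp: tuples_def)

lemma tuples_Suc: "tuples (Suc T) n = (\<lambda>(w, ws). w # ws) ` (words_upto n \<times> tuples T n)"
  by (auto simp: tuples_def length_Suc_conv image_iff)

lemma sum_tuples_prod:
  fixes f :: "bool list \<Rightarrow> real"
  shows "(\<Sum>ws\<in>tuples T n. \<Prod>i<T. f (ws ! i)) = (\<Sum>w\<in>words_upto n. f w) ^ T"
proof (induction T)
  case 0 then show ?case by (simp add: tuples_0)
next
  case (Suc T)
  have "(\<Sum>ws\<in>tuples (Suc T) n. \<Prod>i<Suc T. f (ws ! i)) =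
     (\<Sum>(w, ws)\<in>words_upto n \<times> tuples T n. \<Prod>i<Suc T. f ((w # ws) ! i))"
    unfolding tuples_Suc by (subst sum.reindex) (auto simp: inj_on_def case_prod_beta)
  also have "\<dots> = (\<Sum>w\<in>words_upto n. \<Sum>ws\<in>tuples T n. f w * (\<Prod>i<T. f (ws ! i)))"
    by (simp add: sum.cartesian_product prod.lessThan_Suc_shift del: prod.lessThan_Suc)
  also have "\<dots> = (\<Sum>w\<in>words_upto n. f w) ^ Suc T"
    by (simp add: Suc sum_distrib_left[symmetric] sum_distrib_right[symmetric])
  finally show ?case .
qed

lemma sqrt_prod_lessThan: "sqrt (\<Prod>i<T. g i) = (\<Prod>i<T. sqrt (g i))" for T :: nat
  by (induction T) (simp_all add: real_sqrt_mult)

text \<open>The left side is the Bhattacharyya coefficient \<open>b\<close>. Writing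
  \<open>f w - g w\<close> as a difference of squares of roots, Cauchy-Schwarz bounds the squared L1
  distance by \<open>(2 - 2 * b) * (2 + 2 * b)\<close>.\<close>

lemma sum_sqrt_mult_le_exp:
  fixes f g :: "'a \<Rightarrow> real"
  assumes nn: "\<And>w. w \<in> A \<Longrightarrow> 0 \<le> f w" "\<And>w. w \<in> A \<Longrightarrow> 0 \<le> g w"
    and sum1: "sum f A = 1" "sum g A = 1"
  shows "(\<Sum>w\<in>A. sqrt (f w * g w)) \<le> exp (- (\<Sum>w\<in>A. \<bar>f w - g w\<bar>)\<^sup>2 / 8)"
proof -
  define b where "b = (\<Sum>w\<in>A. sqrt (f w * g w))"
  define t where "t = (\<Sum>w\<in>A. \<bar>f w - g w\<bar>)"
  have minus: "(\<Sum>w\<in>A. (sqrt (f w) - sqrt (g w))\<^sup>2) = 2 - 2 * b"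
  proof -
    have "(\<Sum>w\<in>A. (sqrt (f w) - sqrt (g w))\<^sup>2) = (\<Sum>w\<in>A. f w + g w - 2 * sqrt (f w * g w))"
      using nn by (intro sum.cong) (auto simp: power2_diff real_sqrt_mult)
    then show ?thesis
      by (simp add: sum.distrib sum_subtractf sum_distrib_left[symmetric] sum1 b_def)
  qed
  have plus: "(\<Sum>w\<in>A. (sqrt (f w) + sqrt (g w))\<^sup>2) = 2 + 2 * b"
  proof -
    have "(\<Sum>w\<in>A. (sqrt (f w) + sqrt (g w))\<^sup>2) = (\<Sum>w\<in>A. f w + g w + 2 * sqrt (f w * g w))"
      using nn by (intro sum.cong) (auto simp: power2_sum real_sqrt_mult)
    then show ?thesis
      by (simp add: sum.distrib sum_distrib_left[symmetric] sum1 b_def)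
  qed
  have "t = (\<Sum>w\<in>A. \<bar>sqrt (f w) - sqrt (g w)\<bar> * (sqrt (f w) + sqrt (g w)))"
    unfolding t_def
  proof (intro sum.cong refl)
    fix w assume w: "w \<in> A"
    have "f w - g w = (sqrt (f w) - sqrt (g w)) * (sqrt (f w) + sqrt (g w))"
      using nn[OF w] by (simp add: algebra_simps)
    then show "\<bar>f w - g w\<bar> = \<bar>sqrt (f w) - sqrt (g w)\<bar> * (sqrt (f w) + sqrt (g w))"
      using nn[OF w] by (simp add: abs_mult)
  qed
  then have "t\<^sup>2 \<le> (\<Sum>w\<in>A. \<bar>sqrt (f w) - sqrt (g w)\<bar>\<^sup>2) * (\<Sum>w\<in>A. (sqrt (f w) + sqrt (g w))\<^sup>2)"
    using Cauchy_Schwarz_ineq_sum[of "\<lambda>w. \<bar>sqrt (f w) - sqrt (g w)\<bar>" "\<lambda>w. sqrt (f w) + sqrt (g w)" A]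
    by simp
  also have "\<dots> = 4 * (1 - b\<^sup>2)"
    unfolding power2_abs minus plus by (simp add: power2_eq_square algebra_simps)
  finally have "b\<^sup>2 \<le> 1 - t\<^sup>2 / 4" by simp
  also have "\<dots> \<le> exp (- t\<^sup>2 / 4)" using exp_ge_add_one_self[of "- t\<^sup>2 / 4"] by simp
  also have "\<dots> = (exp (- t\<^sup>2 / 8))\<^sup>2" by (simp add: power2_eq_square flip: exp_add)
  finally have "b \<le> exp (- t\<^sup>2 / 8)" by (rule power2_le_imp_le) simp
  then show ?thesis by (simp add: b_def t_def)
qed

text \<open>
  The witness is the maximum likelihood estimator. If it prefers \<open>y\<close> to the true string \<open>x\<close>, then
  the likelihood of \<open>x\<close> is at most the geometric mean of the two likelihoods, and the sum of the
  latter factorises over the traces.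
\<close>

lemma maximum_likelihood_recon:
  assumes q: "0 \<le> q" "q \<le> 1" and \<epsilon>: "0 \<le> \<epsilon>"
    and sep: "\<And>x y. length x = n \<Longrightarrow> length y = n \<Longrightarrow> x \<noteq> y \<Longrightarrow>
       \<epsilon> \<le> (\<Sum>w\<in>words_upto n. \<bar>trace_law q x w - trace_law q y w\<bar>)"
  shows "\<exists>F. (\<forall>ws. length (F ws) = n) \<and>
     (\<forall>x. length x = n \<longrightarrow> 1 - 2 ^ n * exp (- T * \<epsilon>\<^sup>2 / 8) \<le> recon_prob q x T F)"
proof -
  define X where "X = {x :: bool list. length x = n}"
  define L where "L x ws = (\<Prod>i<T. trace_law q x (ws ! i))" for x ws
  have finX: "finite X" and cardX: "card X = 2 ^ n"
    using finite_lists_length_eq[of "UNIV :: bool set" n] card_lists_length_eq[of "UNIV :: bool set" n]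
    by (simp_all add: X_def)
  have L_nonneg: "0 \<le> L x ws" for x ws
    unfolding L_def by (intro prod_nonneg ballI trace_law_nonneg q)
  have "\<exists>y\<in>X. \<forall>x\<in>X. L x ws \<le> L y ws" for ws
  proof -
    have "(\<lambda>x. L x ws) ` X \<noteq> {}" using cardX by (auto simp: card_gt_0_iff)
    then have "Max ((\<lambda>x. L x ws) ` X) \<in> (\<lambda>x. L x ws) ` X" using finX by (intro Max_in) auto
    then obtain y where "y \<in> X" "L y ws = Max ((\<lambda>x. L x ws) ` X)" by auto
    then show ?thesis using finX by (intro bexI[of _ y]) auto
  qed
  then obtain F where F: "F ws \<in> X" "x \<in> X \<Longrightarrow> L x ws \<le> L (F ws) ws" for x ws
    by metis
  have "1 - 2 ^ n * exp (- T * \<epsilon>\<^sup>2 / 8) \<le> recon_prob q x T F" if x: "length x = n" for x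
  proof -
    have xX: "x \<in> X" using x by (simp add: X_def)
    have law: "sum (trace_law q y) (words_upto n) = 1" if "y \<in> X" for y
      using that sum_trace_law[where q=q and x=y] by (simp add: X_def)
    have "1 - recon_prob q x T F =
       (\<Sum>ws\<in>tuples T n. L x ws) - (\<Sum>ws\<in>tuples T n. if F ws = x then L x ws else 0)"
      unfolding recon_prob_def L_def x sum_tuples_prod by (simp add: law[OF xX])
    also have "\<dots> = (\<Sum>ws\<in>tuples T n. if F ws = x then 0 else L x ws)"
      unfolding sum_subtractf[symmetric] by (intro sum.cong) auto
    also have "\<dots> \<le> (\<Sum>ws\<in>tuples T n. \<Sum>y\<in>X - {x}. sqrt (L x ws * L y ws))"
    proof (intro sum_mono)
      fix ws
      show "(if F ws = x then 0 else L x ws) \<le> (\<Sum>y\<in>X - {x}. sqrt (L x ws * L y ws))"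
      proof (cases "F ws = x")
        case False
        have "L x ws \<le> sqrt (L x ws * L (F ws) ws)"
          using F(2)[OF xX, of ws] L_nonneg[of x ws]
          by (intro real_le_rsqrt) (simp add: power2_eq_square mult_left_mono)
        also have "\<dots> \<le> (\<Sum>y\<in>X - {x}. sqrt (L x ws * L y ws))"
          using finX F(1) False L_nonneg by (intro member_le_sum) auto
        finally show ?thesis using False by simp
      qed (auto intro!: sum_nonneg simp: L_nonneg)
    qed
    also have "\<dots> = (\<Sum>y\<in>X - {x}. \<Sum>ws\<in>tuples T n. sqrt (L x ws * L y ws))"
      by (rule sum.swap)
    also have "\<dots> = (\<Sum>y\<in>X - {x}. (\<Sum>w\<in>words_upto n. sqrt (trace_law q x w * trace_law q y w)) ^ T)"
      unfolding sum_tuples_prod[symmetric]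
      by (simp add: L_def sqrt_prod_lessThan flip: prod.distrib)
    also have "\<dots> \<le> (\<Sum>y\<in>X - {x}. exp (- T * \<epsilon>\<^sup>2 / 8))"
    proof (intro sum_mono)
      fix y assume y: "y \<in> X - {x}"
      define t where "t = (\<Sum>w\<in>words_upto n. \<bar>trace_law q x w - trace_law q y w\<bar>)"
      have "\<epsilon> \<le> t" unfolding t_def using y x by (intro sep) (auto simp: X_def)
      then have t: "\<epsilon>\<^sup>2 \<le> t\<^sup>2" using \<epsilon> by (intro power_mono)
      have "(\<Sum>w\<in>words_upto n. sqrt (trace_law q x w * trace_law q y w)) \<le> exp (- t\<^sup>2 / 8)"
        unfolding t_def using y xX by (intro sum_sqrt_mult_le_exp) (auto simp: law trace_law_nonneg q)
      also have "\<dots> \<le> exp (- \<epsilon>\<^sup>2 / 8)" using t by simp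
      finally have "(\<Sum>w\<in>words_upto n. sqrt (trace_law q x w * trace_law q y w)) ^ T \<le>
         exp (- \<epsilon>\<^sup>2 / 8) ^ T"
        by (intro power_mono sum_nonneg) (auto simp: trace_law_nonneg q)
      then show "(\<Sum>w\<in>words_upto n. sqrt (trace_law q x w * trace_law q y w)) ^ T \<le>
         exp (- T * \<epsilon>\<^sup>2 / 8)"
        by (simp flip: exp_of_nat_mult)
    qed
    also have "\<dots> \<le> 2 ^ n * exp (- T * \<epsilon>\<^sup>2 / 8)"
      using finX cardX by (simp add: card_Diff_singleton_if xX)
    finally show ?thesis by simp
  qed
  then show ?thesis using F(1) by (intro exI[of _ F]) (auto simp: X_def)
qed

section \<open>Aperiodic words\<close>

definition occs :: "bool list \<Rightarrow> bool list \<Rightarrow> nat set" where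
  "occs w x = {k. k < length x \<and> take (length w) (drop k x) = w}"

lemma occ_gf_0_occs: "w \<noteq> [] \<Longrightarrow> occ_gf u 0 w x = (\<Sum>k\<in>occs w x. u ^ k)"
  by (cases w) (simp_all add: occ_gf_0 occs_def)

lemma occs_nth:
  assumes "k \<in> occs w x" "i < length w"
  shows "k + i < length x" "w ! i = x ! (k + i)"
proof -
  have eq: "take (length w) (drop k x) = w" using assms by (simp add: occs_def)
  then have "length w \<le> length x - k" by (metis length_take length_drop min.cobounded1)
  then show "k + i < length x" using assms by simp
  have "w ! i = take (length w) (drop k x) ! i" by (simp add: eq)
  then show "w ! i = x ! (k + i)" using assms \<open>k + i < length x\<close> by simp
qed

lemma occs_imp_period:
  assumes "k \<in> occs w x" "k + p \<in> occs w x" "i + p < length w"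
  shows "w ! i = w ! (i + p)"
  using occs_nth(2)[OF assms(1), of "i + p"] occs_nth(2)[OF assms(2), of i] assms(3)
  by (simp add: add_ac)

lemma occs_cong_prefix:
  assumes "take m x = take m y" "length x = length y" "k + length w \<le> m"
  shows "k \<in> occs w x \<longleftrightarrow> k \<in> occs w y"
proof -
  have "take (length w) (drop k z) = take (length w) (drop k (take m z))" for z :: "bool list"
    using assms(3) by (simp add: drop_take min_def)
  from this[of x] this[of y] have "take (length w) (drop k x) = take (length w) (drop k y)"
    using assms(1) by simp
  then show ?thesis using assms(2) by (simp add: occs_def)
qed

text \<open>
  If \<open>p\<close> and \<open>p'\<close> are periods of the two extensions of \<open>v\<close>, then comparing the last letters at
  distance \<open>p + p'\<close> shows that the two added letters agree.
\<close>

lemma ex_aperiodic_extension: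
  fixes v :: "bool list"
  assumes "2 * a \<le> length v"
  obtains b where "\<And>p. 1 \<le> p \<Longrightarrow> p \<le> a \<Longrightarrow>
     \<exists>i. i + p < length (v @ [b]) \<and> (v @ [b]) ! i \<noteq> (v @ [b]) ! (i + p)"
proof (rule ccontr)
  assume contr: "\<not> thesis"
  define l where "l = length v"
  have per: "\<exists>p. 1 \<le> p \<and> p \<le> a \<and> (\<forall>i. i + p \<le> l \<longrightarrow> (v @ [b]) ! i = (v @ [b]) ! (i + p))" for b
    using contr that[of b] by (auto simp: l_def less_Suc_eq_le)
  obtain p where p: "1 \<le> p" "p \<le> a" "\<And>i. i + p \<le> l \<Longrightarrow> (v @ [True]) ! i = (v @ [True]) ! (i + p)"
    using per[of True] by auto
  obtain r where r: "1 \<le> r" "r \<le> a" "\<And>i. i + r \<le> l \<Longrightarrow> (v @ [False]) ! i = (v @ [False]) ! (i + r)"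
    using per[of False] by auto
  have "p + r \<le> l" using p r assms by (simp add: l_def)
  then obtain s where "l = p + r + s" using le_Suc_ex by blast
  then have l: "length v = p + r + s" by (simp add: l_def)
  have "v ! (r + s) = True"
    using p(3)[of "r + s"] p(1) by (simp add: nth_append l l_def add_ac)
  moreover have "v ! (p + s) = False"
    using r(3)[of "p + s"] r(1) by (simp add: nth_append l l_def add_ac)
  moreover have "v ! s = v ! (p + s)"
    using p(3)[of s] r(1) by (simp add: nth_append l l_def add_ac)
  moreover have "v ! s = v ! (r + s)"
    using r(3)[of s] p(1) by (simp add: nth_append l l_def add_ac)
  ultimately show False by simp
qed

lemma sum_powers_shift:
  fixes u :: "'a :: comm_ring_1"
  assumes "A \<subseteq> {m..<m + N}"
  shows "(\<Sum>k\<in>A. u ^ k) = u ^ m * (\<Sum>j<N. of_bool (m + j \<in> A) * u ^ j)"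
proof -
  have "(\<Sum>k\<in>A. u ^ k) = (\<Sum>k\<in>{m..<m + N}. of_bool (k \<in> A) * u ^ k)"
    using assms by (intro sum.mono_neutral_cong_left) auto
  also have "\<dots> = (\<Sum>j<N. of_bool (m + j \<in> A) * u ^ (m + j))"
    using sum.shift_bounds_nat_ivl[of "\<lambda>k. of_bool (k \<in> A) * u ^ k" 0 m N]
    by (simp add: lessThan_atLeast0 add.commute)
  finally show ?thesis by (simp only: sum_distrib_left power_add mult.left_commute)
qed

text \<open>The terms below \<open>m\<close> cancel. Elements of \<open>A\<close> after
  \<open>m\<close> lie beyond \<open>m + a\<close>. The first element \<open>m + d\<close> of
  \<open>B\<close> after \<open>m\<close> may be closer and yields the term with
  \<open>\<eta>\<close>; the later ones lie more than \<open>a\<close> behind it. All remote terms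
  are collected in the part with the factor \<open>u ^ a\<close>.\<close>

lemma separated_power_sums_diff:
  fixes A B :: "nat set"
  assumes AB: "A \<subseteq> {..<N}" "B \<subseteq> {..<N}" and m: "m \<in> A" "m \<notin> B"
    and agree: "\<And>k. k < m \<Longrightarrow> k \<in> A \<longleftrightarrow> k \<in> B"
    and sepA: "\<And>i j. i \<in> A \<Longrightarrow> j \<in> A \<Longrightarrow> i < j \<Longrightarrow> i + a < j"
    and sepB: "\<And>i j. i \<in> B \<Longrightarrow> j \<in> B \<Longrightarrow> i < j \<Longrightarrow> i + a < j"
  shows "\<exists>\<eta> d c. (\<eta> = 0 \<or> \<eta> = 1) \<and> 1 \<le> d \<and> (\<forall>j. cmod (c j) \<le> 1) \<and>
     (\<forall>u::complex. (\<Sum>k\<in>A. u ^ k) - (\<Sum>k\<in>B. u ^ k) =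
        u ^ m * (1 - \<eta> * u ^ d + u ^ a * (\<Sum>j<N. c j * u ^ j)))"
proof -
  have fin: "finite A" "finite B" using AB finite_subset by auto
  define A' where "A' = A - {..m}"
  define B0 where "B0 = B - {..m}"
  \<comment> \<open>If \<open>B\<close> has no element after \<open>m\<close>, then
    \<open>\<eta>\<close> is 0, and 1 is a default that keeps \<open>1 \<le> d\<close> true.\<close>
  define d where "d = (if B0 = {} then 1 else Min B0 - m)"
  define \<eta> :: complex where "\<eta> = of_bool (B0 \<noteq> {})"
  define B' where "B' = B0 - {m + d}"
  define c :: "nat \<Rightarrow> complex" where "c j = of_bool (m + a + j \<in> A') - of_bool (m + a + j \<in> B')" for j
  have B0: "m + d \<in> B0" "\<And>k. k \<in> B0 \<Longrightarrow> m + d \<le> k" if "B0 \<noteq> {}"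
    using that Min_in[of B0] Min_le[of B0] fin by (auto simp: B0_def d_def)
  have d1: "1 \<le> d"
    using B0 by (cases "B0 = {}") (auto simp: d_def B0_def)
  have A'sub: "A' \<subseteq> {m + a..<m + a + N}"
    using sepA[OF m(1)] AB by (fastforce simp: A'_def)
  have B'sub: "B' \<subseteq> {m + a..<m + a + N}"
  proof
    fix k assume k: "k \<in> B'"
    then have ne: "B0 \<noteq> {}" by (auto simp: B'_def)
    have "m + d < k" using k B0(2)[OF ne, of k] by (auto simp: B'_def)
    then have "m + d + a < k" using k B0(1)[OF ne] by (intro sepB) (auto simp: B'_def B0_def)
    then show "k \<in> {m + a..<m + a + N}" using k AB by (auto simp: B'_def B0_def)
  qed
  have "(\<Sum>k\<in>A. u ^ k) - (\<Sum>k\<in>B. u ^ k) =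
        u ^ m * (1 - \<eta> * u ^ d + u ^ a * (\<Sum>j<N. c j * u ^ j))" for u :: complex
  proof -
    define C where "C = A \<inter> {..<m}"
    have "A = insert m (C \<union> A')" using m by (auto simp: C_def A'_def)
    moreover have "(\<Sum>k\<in>insert m (C \<union> A'). u ^ k) = u ^ m + (\<Sum>k\<in>C \<union> A'. u ^ k)"
      using fin by (intro sum.insert) (auto simp: C_def A'_def)
    moreover have "(\<Sum>k\<in>C \<union> A'. u ^ k) = (\<Sum>k\<in>C. u ^ k) + (\<Sum>k\<in>A'. u ^ k)"
      using fin by (intro sum.union_disjoint) (auto simp: C_def A'_def)
    ultimately have sA: "(\<Sum>k\<in>A. u ^ k) = (\<Sum>k\<in>C. u ^ k) + u ^ m + (\<Sum>k\<in>A'. u ^ k)"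
      by simp
    have "B = C \<union> B0"
    proof (intro set_eqI)
      fix k show "k \<in> B \<longleftrightarrow> k \<in> C \<union> B0"
        using m agree by (cases k m rule: linorder_cases) (auto simp: C_def B0_def)
    qed
    then have "(\<Sum>k\<in>B. u ^ k) = (\<Sum>k\<in>C \<union> B0. u ^ k)" by (rule arg_cong)
    also have "\<dots> = (\<Sum>k\<in>C. u ^ k) + (\<Sum>k\<in>B0. u ^ k)"
      using fin by (intro sum.union_disjoint) (auto simp: C_def B0_def)
    also have "(\<Sum>k\<in>B0. u ^ k) = \<eta> * u ^ (m + d) + (\<Sum>k\<in>B'. u ^ k)"
    proof (cases "B0 = {}")
      case False
      have "finite B0" using fin by (simp add: B0_def)
      from sum.remove[OF this B0(1)[OF False]] False show ?thesis by (simp add: \<eta>_def B'_def)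
    qed (simp add: \<eta>_def B'_def)
    finally have sB: "(\<Sum>k\<in>B. u ^ k) = (\<Sum>k\<in>C. u ^ k) + (\<eta> * u ^ (m + d) + (\<Sum>k\<in>B'. u ^ k))" .
    show ?thesis
      unfolding sA sB sum_powers_shift[OF A'sub] sum_powers_shift[OF B'sub]
      by (simp add: c_def sum_subtractf power_add algebra_simps)
  qed
  moreover have "cmod (c j) \<le> 1" for j by (simp add: c_def of_bool_def)
  moreover have "\<eta> = 0 \<or> \<eta> = 1" by (simp add: \<eta>_def)
  ultimately show ?thesis using d1 by blast
qed

text \<open>\<open>w\<close> consists of the last \<open>2 * a\<close> letters before the first
  difference and one letter that excludes periods up to \<open>a\<close>. This letter equals exactly
  one of \<open>b\<close> and \<open>\<not> b\<close>, so exactly one of the strings has an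
  occurrence at \<open>m\<close>; the sign \<open>\<sigma>\<close> records which. Earlier
  occurrences lie in the common prefix.\<close>

lemma separated_occs_diff:
  assumes len: "length x = length y" and v: "2 * a \<le> length v"
    and xy: "x = v @ b # xs" "y = v @ (\<not> b) # ys"
  obtains w \<sigma> m \<eta> d c where "length w = Suc (2 * a)" "\<sigma> = 1 \<or> \<sigma> = -1" "\<eta> = 0 \<or> \<eta> = 1" "1 \<le> d"
    "\<And>j. cmod (c j) \<le> 1"
    "\<And>u. occ_gf u 0 w x - occ_gf u 0 w y =
       \<sigma> * u ^ m * (1 - \<eta> * u ^ d + u ^ a * (\<Sum>j<length x. c j * u ^ j))"
proof -
  define m where "m = length v - 2 * a"
  define v' where "v' = drop m v"
  have v': "length v' = 2 * a" using v by (simp add: v'_def m_def)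
  obtain e where e: "\<And>p. 1 \<le> p \<Longrightarrow> p \<le> a \<Longrightarrow>
     \<exists>i. i + p < length (v' @ [e]) \<and> (v' @ [e]) ! i \<noteq> (v' @ [e]) ! (i + p)"
    using ex_aperiodic_extension[of a v'] v' by auto
  define w where "w = v' @ [e]"
  have lw: "length w = Suc (2 * a)" by (simp add: w_def v')
  have sep: "i + a < j" if ij: "i \<in> occs w z" "j \<in> occs w z" "i < j" for i j z
  proof (rule ccontr)
    assume "\<not> i + a < j"
    moreover obtain p where p: "j = i + p" using ij(3) less_imp_add_positive by metis
    ultimately obtain k where "k + p < length w" "w ! k \<noteq> w ! (k + p)"
      using e[of p] ij(3) by (auto simp: w_def)
    then show False using occs_imp_period[of i w z p k] ij p by simp
  qed
  have sub: "occs w z \<subseteq> {..<length z}" for z by (auto simp: occs_def)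
  have agree: "k \<in> occs w x \<longleftrightarrow> k \<in> occs w y" if "k < m" for k
    using that lw len v by (intro occs_cong_prefix[of "length v"]) (auto simp: xy m_def)
  have dx: "drop m x = v' @ b # xs" "drop m y = v' @ (\<not> b) # ys"
    by (simp_all add: v'_def m_def xy)
  have "m < length x" "m < length y" by (simp_all add: m_def xy)
  then have memx: "m \<in> occs w x \<longleftrightarrow> b = e" and memy: "m \<in> occs w y \<longleftrightarrow> b \<noteq> e"
    by (auto simp: occs_def dx lw w_def v')
  have ne: "w \<noteq> []" by (simp add: w_def)
  show thesis
  proof (cases "b = e")
    case True
    have "\<exists>\<eta> d c. (\<eta> = 0 \<or> \<eta> = 1) \<and> 1 \<le> d \<and> (\<forall>j. cmod (c j) \<le> 1) \<and>
     (\<forall>u::complex. (\<Sum>k\<in>occs w x. u ^ k) - (\<Sum>k\<in>occs w y. u ^ k) =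
        u ^ m * (1 - \<eta> * u ^ d + u ^ a * (\<Sum>j<length x. c j * u ^ j)))"
      by (rule separated_power_sums_diff)
        (use sub[of x] sub[of y] memx memy True agree sep len in auto)
    then obtain \<eta> d c where *: "\<eta> = 0 \<or> \<eta> = 1" "1 \<le> d" "\<And>j. cmod (c j) \<le> 1"
      "\<And>u. (\<Sum>k\<in>occs w x. u ^ k) - (\<Sum>k\<in>occs w y. u ^ k) =
        u ^ m * (1 - \<eta> * u ^ d + u ^ a * (\<Sum>j<length x. c j * u ^ j))"
      by blast
    show thesis
      by (rule that[OF lw _ *(1-3), of 1 m]) (simp_all only: occ_gf_0_occs[OF ne] *(4) mult_1 simp_thms)
  next
    case False
    have "\<exists>\<eta> d c. (\<eta> = 0 \<or> \<eta> = 1) \<and> 1 \<le> d \<and> (\<forall>j. cmod (c j) \<le> 1) \<and>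
     (\<forall>u::complex. (\<Sum>k\<in>occs w y. u ^ k) - (\<Sum>k\<in>occs w x. u ^ k) =
        u ^ m * (1 - \<eta> * u ^ d + u ^ a * (\<Sum>j<length x. c j * u ^ j)))"
      by (rule separated_power_sums_diff)
        (use sub[of x] sub[of y] memx memy False agree sep len in auto)
    then obtain \<eta> d c where *: "\<eta> = 0 \<or> \<eta> = 1" "1 \<le> d" "\<And>j. cmod (c j) \<le> 1"
      "\<And>u. (\<Sum>k\<in>occs w y. u ^ k) - (\<Sum>k\<in>occs w x. u ^ k) =
        u ^ m * (1 - \<eta> * u ^ d + u ^ a * (\<Sum>j<length x. c j * u ^ j))"
      by blast
    have "(\<Sum>k\<in>occs w x. u ^ k) - (\<Sum>k\<in>occs w y. u ^ k) =
        - (u ^ m * (1 - \<eta> * u ^ d + u ^ a * (\<Sum>j<length x. c j * u ^ j)))" for u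
      unfolding *(4)[symmetric] by simp
    then show thesis
      by (intro that[OF lw _ *(1-3), of "-1" m])
        (simp_all only: occ_gf_0_occs[OF ne] mult_minus_left mult_1 simp_thms)
  qed
qed

section \<open>Lower bounds for analytic functions\<close>

lemma powr_le_affine:
  fixes x \<beta> :: real
  assumes "0 < x" "0 \<le> \<beta>" "\<beta> \<le> 1"
  shows "x powr \<beta> \<le> 1 - \<beta> + \<beta> * x"
  using Youngs_inequality_0[of \<beta> "1 - \<beta>" x 1] assms by simp

lemma cos_mult_ge:
  fixes \<beta> \<phi> :: real
  assumes "0 \<le> \<beta>" "\<beta> \<le> 1" "\<bar>\<phi>\<bar> \<le> pi / 2"
  shows "1 - \<beta> + \<beta> * cos \<phi> \<le> cos (\<beta> * \<phi>)"
proof -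
  have "concave_on {- (pi / 2)..pi / 2} cos"
  proof (rule f''_le0_imp_concave)
    show "(cos has_real_derivative - sin x) (at x)"
      and "((\<lambda>x. - sin x) has_real_derivative - cos x) (at x)" for x
      by (rule derivative_eq_intros refl | simp)+
  qed (auto intro: cos_ge_zero)
  moreover have "- (pi / 2) \<le> \<phi>" "\<phi> \<le> pi / 2" using assms(3) by linarith+
  ultimately show ?thesis
    using concave_onD[of "{- (pi / 2)..pi / 2}" cos \<beta> 0 \<phi>] assms by simp
qed

lemma sin_ge_linear:
  fixes x :: real
  assumes "0 \<le> x" "x \<le> pi / 2"
  shows "2 / pi * x \<le> sin x"
proof -
  have "concave_on {0..pi} sin"
  proof (rule f''_le0_imp_concave)
    show "(sin has_real_derivative cos x) (at x)"
      and "(cos has_real_derivative - sin x) (at x)" for x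
      by (rule derivative_eq_intros refl | simp)+
  qed (auto intro: sin_ge_zero)
  from concave_onD[OF this, of "2 / pi * x" 0 "pi / 2"] show ?thesis
    using assms by (auto simp: field_simps)
qed

text \<open>With \<open>\<rho>\<close> and \<open>\<phi>\<close> the modulus and argument of
  \<open>1 - z\<close>, the right side is \<open>\<rho> powr \<beta> * (2 * cos (\<beta> * \<phi>) -
  \<rho> powr \<beta>)\<close>, and \<open>cmod z < 1\<close> means
  \<open>\<rho> < 2 * cos \<phi>\<close>. The chord bound for \<open>cos\<close> and the tangent
  bound for the power leave at least \<open>1 - \<beta>\<close> in the bracket.\<close>

lemma one_minus_norm_square_ge:
  fixes z :: complex and \<beta> :: real
  assumes \<beta>: "0 \<le> \<beta>" "\<beta> \<le> 1" and z: "cmod z < 1"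
  shows "(1 - \<beta>) * cmod (1 - z) powr \<beta> \<le> 1 - (cmod (1 - (1 - z) powr \<beta>))\<^sup>2"
proof -
  define s where "s = (1 - z) powr of_real \<beta>"
  define \<rho> where "\<rho> = cmod (1 - z)"
  define \<phi> where "\<phi> = Im (Ln (1 - z))"
  have pos: "0 < Re (1 - z)" using z complex_Re_le_cmod[of z] by simp
  then have ne: "1 - z \<noteq> 0" by auto
  have \<phi>: "\<bar>\<phi>\<bar> < pi / 2" unfolding \<phi>_def using pos by (rule Re_Ln_pos_lt_imp)
  have \<rho>: "0 < \<rho>" using ne by (simp add: \<rho>_def)
  have norm_s: "cmod s = \<rho> powr \<beta>" by (simp add: s_def \<rho>_def norm_powr_real_powr')
  have Re_s: "Re s = \<rho> powr \<beta> * cos (\<beta> * \<phi>)"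
    using ne \<rho> by (simp add: s_def powr_def Re_exp \<phi>_def \<rho>_def)
  have Re_z: "Re (1 - z) = \<rho> * cos \<phi>"
  proof -
    have "1 - z = exp (Ln (1 - z))" using ne by simp
    then have "Re (1 - z) = Re (exp (Ln (1 - z)))" by simp
    then show ?thesis using ne by (simp add: Re_exp \<phi>_def \<rho>_def)
  qed
  have "(cmod z)\<^sup>2 < 1" using z by (simp add: power_less_one_iff abs_square_less_1)
  then have "\<rho>\<^sup>2 < 2 * Re (1 - z)"
    unfolding \<rho>_def cmod_power2 by (simp add: power2_eq_square algebra_simps)
  then have "\<rho> < 2 * cos \<phi>" unfolding Re_z using \<rho> by (simp add: power2_eq_square)
  then have "\<beta> * \<rho> \<le> 2 * (\<beta> * cos \<phi>)"
    using mult_left_mono[of \<rho> "2 * cos \<phi>" \<beta>] \<beta> by simp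
  moreover have "1 - \<beta> + \<beta> * cos \<phi> \<le> cos (\<beta> * \<phi>)" using \<beta> \<phi> by (intro cos_mult_ge) auto
  moreover have "\<rho> powr \<beta> \<le> 1 - \<beta> + \<beta> * \<rho>" using \<rho> \<beta> by (intro powr_le_affine)
  ultimately have "1 - \<beta> \<le> 2 * cos (\<beta> * \<phi>) - \<rho> powr \<beta>" by argo
  then have "\<rho> powr \<beta> * (1 - \<beta>) \<le> \<rho> powr \<beta> * (2 * cos (\<beta> * \<phi>) - \<rho> powr \<beta>)"
    by (intro mult_left_mono) auto
  also have "\<dots> = 2 * Re s - (cmod s)\<^sup>2"
    by (simp add: Re_s norm_s power2_eq_square algebra_simps)
  also have "\<dots> = 1 - (cmod (1 - s))\<^sup>2"
    unfolding cmod_power2 by (simp add: power2_eq_square algebra_simps)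
  finally show ?thesis by (simp add: s_def \<rho>_def mult.commute)
qed

lemma norm_one_minus_rcis_square:
  "(cmod (1 - of_real r * cis \<theta>))\<^sup>2 = (1 - r)\<^sup>2 + 4 * r * (sin (\<theta> / 2))\<^sup>2"
proof -
  have c: "cos \<theta> = 1 - 2 * (sin (\<theta> / 2))\<^sup>2"
    using cos_double_sin[of "\<theta> / 2"] by simp
  have "(cmod (1 - of_real r * cis \<theta>))\<^sup>2 = (1 - r * cos \<theta>)\<^sup>2 + (r * sin \<theta>)\<^sup>2"
    by (simp add: cmod_power2)
  also have "\<dots> = 1 - 2 * r * cos \<theta> + r\<^sup>2 * ((sin \<theta>)\<^sup>2 + (cos \<theta>)\<^sup>2)"
    by (simp only: power2_eq_square) (simp only: algebra_simps)
  also have "\<dots> = 1 - 2 * r * cos \<theta> + r\<^sup>2" by simp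
  finally show ?thesis unfolding c by (simp add: power2_eq_square algebra_simps)
qed

section \<open>Products over rotated roots of unity\<close>

lemma prod_lessThan_rotate:
  fixes f :: "nat \<Rightarrow> 'a :: comm_monoid_mult"
  assumes "f m = f 0"
  shows "(\<Prod>j<m. f (Suc j)) = (\<Prod>j<m. f j)"
proof (cases m)
  case (Suc k)
  then show ?thesis
    using assms prod.lessThan_Suc_shift[of f k] by (simp add: mult.commute del: prod.lessThan_Suc)
      (simp add: mult.commute)
qed simp

text \<open>The product \<open>H\<close> of the rotates of \<open>F\<close> is 1 at 0, so by the
  maximum principle it has modulus at least 1 somewhere on the circle of radius \<open>r\<close>.
  Turning by \<open>2 * pi / m\<close> permutes the factors, so the angle can be reduced modulo that
  step.\<close>

lemma ex_rotation_prod_ge_1: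
  fixes F :: "complex \<Rightarrow> complex" and m :: nat
  assumes F: "F holomorphic_on ball 0 1" "F 0 = 1" and r: "0 < r" "r < 1" and m: "0 < m"
  obtains t where "0 \<le> t" "t < 2 * pi / real m"
    "1 \<le> (\<Prod>j<m. cmod (F (of_real r * cis (t + 2 * pi * real j / real m))))"
proof -
  define G where "G \<theta> = (\<Prod>j<m. cmod (F (of_real r * cis (\<theta> + 2 * pi * real j / real m))))" for \<theta>
  define H where "H z = (\<Prod>j<m. F (z * cis (2 * pi * real j / real m)))" for z
  have hol: "H holomorphic_on ball 0 1"
    unfolding H_def
  proof (intro holomorphic_on_prod)
    fix j
    have "F \<circ> (\<lambda>z. z * cis (2 * pi * real j / real m)) holomorphic_on ball 0 1"
      by (rule holomorphic_on_compose_gen[OF _ F(1)]) (auto intro!: holomorphic_intros simp: norm_mult)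
    then show "(\<lambda>z. F (z * cis (2 * pi * real j / real m))) holomorphic_on ball 0 1"
      by (simp add: o_def)
  qed
  have sub: "cball 0 r \<subseteq> ball (0::complex) 1" using r by auto
  have cont: "continuous_on (cball 0 r) H"
    using holomorphic_on_imp_continuous_on[OF hol] sub by (rule continuous_on_subset)
  have "\<exists>z0\<in>sphere 0 r. \<forall>z\<in>sphere 0 r. cmod (H z) \<le> cmod (H z0)"
  proof (rule continuous_attains_sup)
    show "continuous_on (sphere 0 r) (\<lambda>z. cmod (H z))"
      by (rule continuous_on_norm, rule continuous_on_subset[OF cont]) simp
  qed (use r in simp_all)
  then obtain z0 where z0: "cmod z0 = r" "\<And>z. cmod z = r \<Longrightarrow> cmod (H z) \<le> cmod (H z0)"
    by auto
  have "cmod (H 0) \<le> cmod (H z0)"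
  proof (rule maximum_modulus_frontier[of H "cball 0 r"])
    show "H holomorphic_on interior (cball 0 r)"
      by (rule holomorphic_on_subset[OF hol]) (use sub interior_subset in blast)
  qed (use z0 r cont in auto)
  then have "\<exists>z. cmod z = r \<and> 1 \<le> cmod (H z)"
    using z0(1) F(2) by (auto simp: H_def)
  then obtain z where z: "cmod z = r" "1 \<le> cmod (H z)" by auto
  define \<theta> where "\<theta> = Arg2pi z"
  have \<theta>: "0 \<le> \<theta>" "z = of_real r * cis \<theta>"
    using z(1) Arg2pi_eq[of z] by (auto simp: \<theta>_def Arg2pi_ge_0 cis_conv_exp)
  have G1: "1 \<le> G \<theta>"
    using z(2) by (simp add: H_def G_def \<theta>(2) prod_norm[symmetric] mult.assoc cis_mult)
  define \<delta> where "\<delta> = 2 * pi / real m"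
  have \<delta>: "0 < \<delta>" using m by (simp add: \<delta>_def)
  have shift: "G (\<theta> + \<delta>) = G \<theta>" for \<theta>
  proof -
    define f where "f j = cmod (F (of_real r * cis (\<theta> + 2 * pi * real j / real m)))" for j
    have "f m = f 0" using m by (simp add: f_def cis_mult[symmetric])
    then have "(\<Prod>j<m. f (Suc j)) = (\<Prod>j<m. f j)" by (rule prod_lessThan_rotate)
    then show ?thesis by (simp add: G_def f_def \<delta>_def add_divide_distrib algebra_simps)
  qed
  have shifts: "G (\<theta> + real k * \<delta>) = G \<theta>" for k \<theta>
  proof (induction k)
    case (Suc k)
    then show ?case using shift[of "\<theta> + real k * \<delta>"] by (simp add: algebra_simps)
  qed simp
  define k where "k = nat \<lfloor>\<theta> / \<delta>\<rfloor>"
  define t where "t = \<theta> - real k * \<delta>"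
  have "0 \<le> \<theta> / \<delta>" using \<theta>(1) \<delta> by simp
  then have "real k \<le> \<theta> / \<delta>" "\<theta> / \<delta> < real k + 1"
    unfolding k_def by linarith+
  then have "real k * \<delta> \<le> \<theta>" "\<theta> < (real k + 1) * \<delta>"
    using \<delta> by (simp_all only: pos_le_divide_eq pos_divide_less_eq)
  then have "0 \<le> t" "t < \<delta>" by (simp_all add: t_def algebra_simps)
  moreover have "1 \<le> G t" using G1 shifts[of t k] by (simp add: t_def)
  ultimately show thesis using that by (simp add: G_def \<delta>_def)
qed

text \<open>Half the angle lies between \<open>pi * K / m\<close> and its supplement, where the sine
  is bounded below by a chord. The bound on \<open>r\<close> gives
  \<open>1 \<le> 4 * r\<close>.\<close>

lemma norm_one_minus_rcis_ge:
  fixes r t :: real and j K m :: nat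
  assumes r: "1 / 4 \<le> r" and t: "0 \<le> t" "t < 2 * pi / real m" and j: "K \<le> j" "j + K < m"
  shows "2 * K / m \<le> cmod (1 - of_real r * cis (t + 2 * pi * j / m))"
proof -
  define \<alpha> where "\<alpha> = (t + 2 * pi * j / m) / 2"
  have m: "0 < real m" using j by simp
  have \<alpha>: "\<alpha> = t / 2 + pi * j / m" by (simp add: \<alpha>_def add_divide_distrib)
  have "pi * K / m \<le> pi * j / m" using m j(1) by (intro divide_right_mono mult_left_mono) auto
  then have lo: "pi * K / m \<le> \<alpha>" using t(1) by (simp add: \<alpha>)
  have nonneg: "0 \<le> pi * K / m" by simp
  have hi: "\<alpha> \<le> pi - pi * K / m"
  proof -
    \<comment> \<open>Strictness of \<open>j + K < m\<close> leaves one grid step, which absorbs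
      \<open>t\<close>.\<close>
    have "real j + 1 + real K \<le> real m" using j by linarith
    then have "pi * (real j + 1 + real K) / m \<le> pi * m / m"
      using m by (intro divide_right_mono mult_left_mono) auto
    also have "pi * (real j + 1 + real K) / m = pi * j / m + pi / m + pi * K / m"
      by (simp add: distrib_left add_divide_distrib)
    also have "pi * m / m = pi" using m by simp
    finally have "pi * j / m + pi / m + pi * K / m \<le> pi" .
    moreover have "t / 2 \<le> pi / m" using t(2) by (simp add: mult.commute)
    ultimately show ?thesis unfolding \<alpha> by linarith
  qed
  have scale: "2 / pi * (pi * K / m) = 2 * K / m" by simp
  have "2 * K / m \<le> sin \<alpha>"
  proof (cases "\<alpha> \<le> pi / 2")
    case True
    have "0 \<le> \<alpha>" using lo nonneg by linarith
    from this True have "2 / pi * \<alpha> \<le> sin \<alpha>" by (rule sin_ge_linear)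
    moreover have "2 / pi * (pi * K / m) \<le> 2 / pi * \<alpha>" using lo by (intro mult_left_mono) auto
    ultimately show ?thesis unfolding scale by simp
  next
    case False
    have "0 \<le> pi - \<alpha>" using hi nonneg by linarith
    moreover have "pi - \<alpha> \<le> pi / 2" using False by simp
    ultimately have "2 / pi * (pi - \<alpha>) \<le> sin (pi - \<alpha>)" by (rule sin_ge_linear)
    moreover have "2 / pi * (pi * K / m) \<le> 2 / pi * (pi - \<alpha>)" using hi by (intro mult_left_mono) auto
    ultimately show ?thesis unfolding scale by simp
  qed
  then have "(2 * K / m)\<^sup>2 \<le> (sin \<alpha>)\<^sup>2" by (intro power_mono) auto
  also have "\<dots> \<le> 4 * r * (sin \<alpha>)\<^sup>2" using r by (simp add: mult_le_cancel_right1)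
  also have "\<dots> \<le> (cmod (1 - of_real r * cis (t + 2 * pi * j / m)))\<^sup>2"
    unfolding norm_one_minus_rcis_square \<alpha>_def[symmetric] by simp
  finally show ?thesis by (rule power2_le_imp_le) simp
qed

lemma half_le_powr:
  fixes y \<beta> :: real
  assumes "0 < y" "y \<le> 2" "0 \<le> \<beta>" "\<beta> \<le> 1"
  shows "y / 2 \<le> y powr \<beta>"
proof -
  have "y / 2 = (y / 2) powr 1" using assms by simp
  also have "\<dots> \<le> (y / 2) powr \<beta>" using assms by (intro powr_mono') auto
  also have "\<dots> \<le> y powr \<beta>" using assms by (intro powr_mono2) auto
  finally show ?thesis .
qed

text \<open>Bounds the denominator of \<open>F\<close> by the same quantity that
  \<open>one_minus_norm_square_ge\<close> controls.\<close>

lemma norm_one_minus_root_ge: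
  fixes w \<eta> :: complex
  assumes "cmod w < 1" "cmod \<eta> \<le> 1" "1 \<le> d"
  shows "(1 - (cmod w)\<^sup>2) / 2 \<le> cmod (1 - \<eta> * w ^ d)"
proof -
  have "cmod (\<eta> * w ^ d) \<le> 1 * cmod w ^ 1"
    unfolding norm_mult norm_power using assms by (intro mult_mono power_decreasing) auto
  then have "1 - cmod w \<le> cmod (1 - \<eta> * w ^ d)"
    using norm_triangle_ineq2[of 1 "\<eta> * w ^ d"] by simp
  moreover have "0 \<le> (1 - cmod w)\<^sup>2" by simp
  then have "1 - (cmod w)\<^sup>2 \<le> 2 * (1 - cmod w)" by (simp add: power2_eq_square algebra_simps)
  ultimately show ?thesis by simp
qed

lemma norm_one_minus_rcis_le:
  assumes "0 \<le> r" "r \<le> 1" "0 \<le> t"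
  shows "cmod (1 - of_real r * cis t) \<le> 1 - r + t"
proof (rule power2_le_imp_le)
  have "(sin (t / 2))\<^sup>2 \<le> (t / 2)\<^sup>2"
    using abs_sin_x_le_abs_x[of "t / 2"] abs_le_square_iff by blast
  then have "4 * r * (sin (t / 2))\<^sup>2 \<le> 4 * 1 * (t / 2)\<^sup>2"
    using assms by (intro mult_mono) auto
  also have "\<dots> = t\<^sup>2" by (simp add: power2_eq_square)
  finally have "(cmod (1 - of_real r * cis t))\<^sup>2 \<le> (1 - r)\<^sup>2 + t\<^sup>2"
    unfolding norm_one_minus_rcis_square by simp
  also have "\<dots> \<le> (1 - r + t)\<^sup>2" using assms by (simp add: power2_sum)
  finally show "(cmod (1 - of_real r * cis t))\<^sup>2 \<le> (1 - r + t)\<^sup>2" .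
qed (use assms in simp)

text \<open>
  Among the factors \<open>F (z j)\<close> of the rotated product, those with index in \<open>B\<close> are merely bounded by \<open>N ^ 5\<close>,
  all others by \<open>1 + 1 / m\<close>. The radius \<open>r < 1\<close> keeps the denominators \<open>D\<close> of the factors in \<open>B\<close> away
  from \<open>0\<close>.
\<close>

lemma ex_large_value_in_disc:
  fixes Q :: "complex \<Rightarrow> complex" and \<eta> :: complex and a d :: nat and N :: real
  assumes hol: "Q holomorphic_on UNIV" and bound: "\<And>z. cmod z \<le> 1 \<Longrightarrow> cmod (Q z) \<le> N"
    and \<eta>: "cmod \<eta> \<le> 1" and d: "1 \<le> d" and a: "2 \<le> a" and N: "real a ^ 2 \<le> N"
  obtains w where "cmod w < 1" "cmod (1 - w) \<le> 27 / real a ^ 2"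
    "exp (- (1 + 10 * (8 * a * (ln N)\<^sup>2 + 1) * ln N)) \<le> cmod (1 - \<eta> * w ^ d + w ^ a * Q w)"
proof -
  define L where "L = ln N"
  \<comment> \<open>\<open>1 - \<beta> = 1 / L\<close> costs a logarithm in the distance to the unit
    circle, while \<open>(9 / m) powr \<beta>\<close> stays within a factor \<open>exp 1\<close> of
    \<open>9 / m\<close>.\<close>
  define \<beta> where "\<beta> = 1 - 1 / L"
  define m where "m = a\<^sup>2"
  \<comment> \<open>This gives \<open>1 / N \<le> cmod (1 - z j)\<close> at all sample points and
    still \<open>1 - r \<le> 1 / m\<close>.\<close>
  define r where "r = 1 - 1 / N"
  \<comment> \<open>Chosen such that \<open>8 * L \<le> a * X\<close> below, whence
    \<open>cmod (h (z j)) ^ a \<le> 1 / N ^ 4\<close> away from 1.\<close>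
  define K where "K = nat \<lceil>8 * a * L\<^sup>2\<rceil>"
  define P where "P w = 1 - \<eta> * w ^ d + w ^ a * Q w" for w
  define D where "D w = 1 - \<eta> * w ^ d" for w
  define h where "h z = 1 - (1 - z) powr (of_real \<beta> :: complex)" for z
  define F where "F z = P (h z) / D (h z)" for z
  have aN: "2 \<le> real a" "real a \<le> N" "4 \<le> N" "real m \<le> N"
  proof -
    show "2 \<le> real a" using a by simp
    then have "2 * 2 \<le> real a * real a" "1 * real a \<le> real a * real a" by (intro mult_mono; simp)+
    then show "real a \<le> N" "4 \<le> N" "real m \<le> N" using N by (simp_all add: power2_eq_square m_def)
  qed
  have m: "0 < real m" "0 < m" using a by (simp_all add: m_def)
  have L: "1 < L"
  proof -
    have "exp 1 < N" using exp_le aN by linarith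
    then have "ln (exp 1) < ln N" using aN by (subst ln_less_cancel_iff) auto
    then show ?thesis by (simp add: L_def)
  qed
  have LN: "L \<le> N" "exp L = N" using aN ln_le_minus_one[of N] by (simp_all add: L_def)
  have \<beta>: "0 \<le> \<beta>" "\<beta> \<le> 1" "1 - \<beta> = 1 / L" using L by (simp_all add: \<beta>_def)
  have r: "1 / 4 \<le> r" "0 < r" "r < 1" "1 - r = 1 / N" using aN by (simp_all add: r_def field_simps)
  have K: "8 * a * L\<^sup>2 \<le> K" "K \<le> 8 * a * L\<^sup>2 + 1" "1 \<le> K"
  proof -
    have pos: "0 < 8 * a * L\<^sup>2" using aN L by simp
    then show "8 * a * L\<^sup>2 \<le> K" "K \<le> 8 * a * L\<^sup>2 + 1" unfolding K_def by linarith+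
    then show "1 \<le> K" using pos by linarith
  qed
  have gap: "cmod (1 - z) powr \<beta> / L \<le> 1 - (cmod (h z))\<^sup>2" if "cmod z < 1" for z
    using one_minus_norm_square_ge[OF \<beta>(1,2) that] by (simp add: \<beta>(3) h_def)
  have h_lt: "cmod (h z) < 1" if "cmod z < 1" for z
  proof -
    have "z \<noteq> 1" using that by auto
    then have "0 < cmod (1 - z) powr \<beta> / L" using L by simp
    with gap[OF that] have "(cmod (h z))\<^sup>2 < 1" by linarith
    then show ?thesis by (simp add: abs_square_less_1)
  qed
  have D_ge: "(1 - (cmod (h z))\<^sup>2) / 2 \<le> cmod (D (h z))" if "cmod z < 1" for z
    unfolding D_def using h_lt[OF that] \<eta> d by (rule norm_one_minus_root_ge)
  have D_nz: "D (h z) \<noteq> 0" if "cmod z < 1" for z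
  proof -
    have "(cmod (h z))\<^sup>2 < 1" using h_lt[OF that] by (simp add: abs_square_less_1)
    with D_ge[OF that] show ?thesis by auto
  qed
  have hol_h: "h holomorphic_on ball 0 1"
    unfolding h_def
  proof (intro holomorphic_intros)
    fix z :: complex assume "z \<in> ball 0 1"
    then have "0 < Re (1 - z)" using complex_Re_le_cmod[of z] by simp
    then show "1 - z \<notin> \<real>\<^sub>\<le>\<^sub>0" by (auto simp: complex_nonpos_Reals_iff)
  qed
  have hol_Qh: "(\<lambda>z. Q (h z)) holomorphic_on ball 0 1"
    using holomorphic_on_compose[OF hol_h holomorphic_on_subset[OF hol]] by (simp add: o_def)
  have "F holomorphic_on ball 0 1"
    unfolding F_def P_def using hol_h hol_Qh D_nz
    by (intro holomorphic_intros) (auto simp: D_def intro!: holomorphic_intros)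
  moreover have "F 0 = 1" using a d by (simp add: F_def P_def D_def h_def zero_power)
  ultimately obtain t where t: "0 \<le> t" "t < 2 * pi / real m"
    "1 \<le> (\<Prod>j<m. cmod (F (of_real r * cis (t + 2 * pi * real j / real m))))"
    using ex_rotation_prod_ge_1[of F r m] r m(2) by blast
  define z where "z j = of_real r * cis (t + 2 * pi * real j / real m)" for j
  have z: "cmod (z j) = r" "cmod (z j) < 1" for j using r by (simp_all add: z_def norm_mult)
  have y: "1 / N \<le> cmod (1 - z j)" "cmod (1 - z j) \<le> 2" "0 < cmod (1 - z j)" for j
  proof -
    have "1 / N > 0" using aN by simp
    moreover show "1 / N \<le> cmod (1 - z j)"
      using norm_triangle_ineq2[of 1 "z j"] z r by simp
    ultimately show "0 < cmod (1 - z j)" by linarith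
    show "cmod (1 - z j) \<le> 2" using norm_triangle_ineq4[of 1 "z j"] z[of j] by simp
  qed
  have half: "cmod (1 - z j) / 2 \<le> cmod (1 - z j) powr \<beta>" for j
    using y \<beta> by (intro half_le_powr) auto
  have P_le: "cmod (P w) \<le> N\<^sup>2" if "cmod w < 1" for w
  proof -
    have "cmod (P w) \<le> cmod (1 - \<eta> * w ^ d) + cmod (w ^ a * Q w)"
      unfolding P_def by (rule norm_triangle_ineq)
    also have "\<dots> \<le> (cmod 1 + cmod (\<eta> * w ^ d)) + cmod (w ^ a * Q w)"
      by (intro add_mono norm_triangle_ineq4 order_refl)
    also have "\<dots> \<le> (1 + 1 * 1) + 1 * N"
      unfolding norm_mult norm_power using \<eta> that bound[of w]
      by (intro add_mono mult_mono power_le_one) auto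
    also have "\<dots> \<le> 4 * N" using aN by simp
    also have "\<dots> \<le> N * N" using aN by (intro mult_right_mono) auto
    finally show ?thesis by (simp add: power2_eq_square)
  qed
  \<comment> \<open>A crude bound valid at every sample point: the denominator is at least
    \<open>1 / (4 * (L * N))\<close>. The numerator stays explicit for the sake of index 0.\<close>
  have F_le: "cmod (F (z j)) \<le> cmod (P (h (z j))) * N ^ 3" for j
  proof -
    have "1 / (4 * (L * N)) = 1 / N / 2 / L / 2" by simp
    also have "\<dots> \<le> cmod (1 - z j) powr \<beta> / L / 2"
      using y(1)[of j] half[of j] L by (intro divide_right_mono) auto
    also have "\<dots> \<le> (1 - (cmod (h (z j)))\<^sup>2) / 2"
      using gap[OF z(2)[of j]] by (rule divide_right_mono) simp
    also have "\<dots> \<le> cmod (D (h (z j)))" using z(2) by (rule D_ge)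
    finally have "1 / cmod (D (h (z j))) \<le> 1 / (1 / (4 * (L * N)))"
      using L aN D_nz[OF z(2)[of j]] by (intro divide_left_mono) auto
    also have "\<dots> = 4 * (L * N)" by simp
    also have "\<dots> \<le> N * (N * N)" using LN aN L by (intro mult_mono) auto
    finally have "cmod (P (h (z j))) * (1 / cmod (D (h (z j)))) \<le> cmod (P (h (z j))) * (N * (N * N))"
      by (intro mult_left_mono) auto
    then show ?thesis by (simp add: F_def norm_divide power3_eq_cube)
  qed
  have F_le5: "cmod (F (z j)) \<le> N ^ 5" for j
  proof -
    have "cmod (F (z j)) \<le> cmod (P (h (z j))) * N ^ 3" by (rule F_le)
    also have "\<dots> \<le> N\<^sup>2 * N ^ 3" using P_le h_lt z(2) aN by (intro mult_right_mono) auto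
    finally show ?thesis by (simp flip: power_add)
  qed
  \<comment> \<open>Here \<open>F - 1\<close> is \<open>h ^ a * Q / D\<close>. The factor
    \<open>1 / N ^ 4\<close> beats the bound \<open>N\<close> for \<open>Q\<close> and
    \<open>a\<close> for \<open>1 / D\<close> and leaves at most \<open>1 / m\<close>, so the
    product of all these factors is at most \<open>exp 1\<close>.\<close>
  have F_far: "cmod (F (z j)) \<le> 1 + 1 / m" if j: "K \<le> j" "j + K < m" for j
  proof -
    define X where "X = K / m / L"
    have "2 * K / m \<le> cmod (1 - z j)"
      unfolding z_def using r(1) t(1,2) j by (rule norm_one_minus_rcis_ge)
    then have "2 * K / m / 2 \<le> cmod (1 - z j) / 2" by (rule divide_right_mono) simp
    then have "K / m \<le> cmod (1 - z j) / 2" by simp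
    also have "\<dots> \<le> cmod (1 - z j) powr \<beta>" by (rule half)
    finally have "X \<le> cmod (1 - z j) powr \<beta> / L"
      unfolding X_def using L by (intro divide_right_mono) auto
    with gap[OF z(2)[of j]] have hX: "(cmod (h (z j)))\<^sup>2 \<le> 1 - X" by linarith
    have aX: "8 * L \<le> a * X"
    proof -
      have "8 * L = 8 * a * L\<^sup>2 / (a * L)" using aN L by (simp add: power2_eq_square)
      also have "\<dots> \<le> K / (a * L)" using K(1) aN L by (intro divide_right_mono) auto
      also have "\<dots> = a * X" using aN by (simp add: X_def m_def power2_eq_square)
      finally show ?thesis .
    qed
    then have X: "1 / a \<le> X / 2" using aN L by (simp add: field_simps)
    have "(cmod (h (z j)) ^ a)\<^sup>2 = ((cmod (h (z j)))\<^sup>2) ^ a"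
      by (simp add: power_mult[symmetric] mult.commute)
    also have "\<dots> \<le> exp (- X) ^ a"
      using hX exp_ge_add_one_self[of "- X"] by (intro power_mono) auto
    also have "\<dots> = exp (- (a * X))" by (simp flip: exp_of_nat_mult)
    also have "\<dots> \<le> exp (- (8 * L))" using aX by simp
    also have "\<dots> = (exp (- (4 * L)))\<^sup>2" by (simp add: power2_eq_square flip: exp_add)
    finally have "cmod (h (z j)) ^ a \<le> exp (- (4 * L))" by (rule power2_le_imp_le) simp
    also have "\<dots> = 1 / N ^ 4" using LN exp_of_nat_mult[of 4 L] by (simp add: exp_minus field_simps)
    finally have ha: "cmod (h (z j)) ^ a \<le> 1 / N ^ 4" .
    have "X / 2 \<le> (1 - (cmod (h (z j)))\<^sup>2) / 2" using hX by simp
    with X D_ge[OF z(2)[of j]] have D_ge': "1 / a \<le> cmod (D (h (z j)))"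
      by (blast intro: order_trans)
    have "F (z j) = 1 + h (z j) ^ a * Q (h (z j)) / D (h (z j))"
      using D_nz[OF z(2)[of j]] by (simp add: F_def P_def D_def field_simps)
    then have "cmod (F (z j)) \<le> 1 + cmod (h (z j) ^ a * Q (h (z j)) / D (h (z j)))"
      using norm_triangle_ineq[of 1 "h (z j) ^ a * Q (h (z j)) / D (h (z j))"] by simp
    also have "cmod (h (z j) ^ a * Q (h (z j)) / D (h (z j))) \<le> 1 / N ^ 4 * N / (1 / a)"
      unfolding norm_divide norm_mult norm_power using ha D_ge' bound[of "h (z j)"] h_lt[OF z(2)[of j]] aN
      by (intro frac_le mult_mono) auto
    also have "\<dots> = a / N ^ 3" using aN by (simp add: power_def field_simps eval_nat_numeral)
    also have "\<dots> \<le> 1 / m"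
    proof -
      have "a * real m \<le> N * N" using aN by (intro mult_mono) auto
      also have "\<dots> * 1 \<le> N * N * N" using aN by (intro mult_left_mono) auto
      finally show ?thesis using m aN by (simp add: field_simps power3_eq_cube)
    qed
    finally show ?thesis by simp
  qed
  \<comment> \<open>Index 0 has angle \<open>t < 2 * pi / m\<close>, so \<open>z 0\<close> is
    certain to be close to 1.\<close>
  define w where "w = h (z 0)"
  define B where "B = {j. j < m \<and> (j < K \<or> m \<le> j + K)}"
  have B: "finite B" "card B \<le> 2 * K" "0 \<in> B" "B \<subseteq> {..<m}"
  proof -
    have sub: "B \<subseteq> {..<K} \<union> {m - K..<m}" by (auto simp: B_def)
    then have "card B \<le> card ({..<K} \<union> {m - K..<m})" by (intro card_mono) auto
    also have "\<dots> \<le> card {..<K} + card {m - K..<m}" by (rule card_Un_le)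
    finally show "card B \<le> 2 * K" by simp
    show "finite B" using sub by (rule finite_subset) auto
    show "0 \<in> B" "B \<subseteq> {..<m}" using K m by (auto simp: B_def)
  qed
  have N1: "1 \<le> N" using aN by simp
  \<comment> \<open>Index 0 is split off: its factor keeps \<open>cmod (P w)\<close>, the quantity
    to be bounded below.\<close>
  have "(\<Prod>j\<in>B - {0}. cmod (F (z j))) \<le> (N ^ 5) ^ (2 * K - 1)"
    using B N1 by (intro prod_le_power) (auto simp: F_le5)
  moreover have "cmod (F (z 0)) \<le> cmod (P w) * N ^ 5"
  proof -
    have "cmod (P w) * N ^ 3 \<le> cmod (P w) * N ^ 5"
      using N1 by (intro mult_left_mono power_increasing) auto
    then show ?thesis using F_le[of 0] by (simp add: w_def)
  qed
  ultimately have "(\<Prod>j\<in>B. cmod (F (z j))) \<le> cmod (P w) * N ^ 5 * (N ^ 5) ^ (2 * K - 1)"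
    unfolding prod.remove[OF B(1,3)] using N1 by (intro mult_mono prod_nonneg) auto
  also have "\<dots> = cmod (P w) * (N ^ 5) ^ (2 * K)"
    using K(3) by (cases "2 * K") auto
  finally have prodB: "(\<Prod>j\<in>B. cmod (F (z j))) \<le> cmod (P w) * (N ^ 5) ^ (2 * K)" .
  have "(\<Prod>j\<in>{..<m} - B. cmod (F (z j))) \<le> (1 + 1 / m) ^ m"
    using card_Diff_subset[OF B(1,4)] by (intro prod_le_power) (auto simp: B_def not_less intro: F_far)
  also have "\<dots> \<le> exp (1 / m) ^ m" using exp_ge_add_one_self[of "1 / m"] by (intro power_mono) auto
  also have "\<dots> = exp 1" using m by (simp flip: exp_of_nat_mult)
  finally have prodF: "(\<Prod>j\<in>{..<m} - B. cmod (F (z j))) \<le> exp 1" .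
  have "1 \<le> (\<Prod>j\<in>{..<m} - B. cmod (F (z j))) * (\<Prod>j\<in>B. cmod (F (z j)))"
    using t(3) prod.subset_diff[OF B(4), of "\<lambda>j. cmod (F (z j))"] by (simp add: z_def)
  also have "\<dots> \<le> exp 1 * (cmod (P w) * (N ^ 5) ^ (2 * K))"
    using prodF prodB by (intro mult_mono prod_nonneg) auto
  also have "(N ^ 5) ^ (2 * K) = exp (10 * K * L)"
    using LN exp_of_nat_mult[of "5 * (2 * K)" L] by (simp add: power_mult[symmetric])
  finally have "1 \<le> cmod (P w) * exp (1 + 10 * K * L)"
    by (simp add: exp_add mult_ac)
  then have "exp (- (1 + 10 * K * L)) * 1 \<le> exp (- (1 + 10 * K * L)) * (cmod (P w) * exp (1 + 10 * K * L))"
    by (rule mult_left_mono) simp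
  also have "\<dots> = cmod (P w)" unfolding exp_minus by simp
  finally have "exp (- (1 + 10 * K * L)) \<le> cmod (P w)" by simp
  moreover have "10 * K * L \<le> 10 * (8 * a * L\<^sup>2 + 1) * L"
    using K(2) L by (intro mult_right_mono) auto
  then have "exp (- (1 + 10 * (8 * a * L\<^sup>2 + 1) * L)) \<le> exp (- (1 + 10 * K * L))" by simp
  ultimately have large: "exp (- (1 + 10 * (8 * a * L\<^sup>2 + 1) * L)) \<le> cmod (P w)" by linarith
  have "cmod (1 - w) = cmod (1 - z 0) powr \<beta>"
    by (simp add: w_def h_def norm_powr_real_powr')
  also have "\<dots> \<le> (9 / m) powr \<beta>"
  proof (rule powr_mono2)
    have "cmod (1 - z 0) \<le> 1 - r + t"
      using norm_one_minus_rcis_le[of r t] r t by (simp add: z_def)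
    also have "\<dots> \<le> 1 / m + 8 / m"
    proof (rule add_mono)
      show "1 - r \<le> 1 / m" unfolding r(4) using aN m by (intro divide_left_mono) auto
      have "2 * pi / m \<le> 8 / m" using pi_less_4 by (intro divide_right_mono) auto
      then show "t \<le> 8 / m" using t by linarith
    qed
    finally show "cmod (1 - z 0) \<le> 9 / m" by (simp add: add_divide_distrib[symmetric])
  qed (use \<beta> in auto)
  also have "(9 / m) powr \<beta> = 9 / m * (9 / m) powr (- (1 / L))"
    using m by (simp add: \<beta>_def powr_diff powr_minus divide_inverse)
  also have "\<dots> \<le> 9 / m * exp 1"
  proof (rule mult_left_mono)
    have "ln m \<le> L" unfolding L_def using m aN by simp
    moreover have "0 \<le> ln (9::real)" by simp
    ultimately have "ln m - ln 9 \<le> L" by linarith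
    then have "- (1 / L) * (ln 9 - ln m) \<le> 1" using L by (simp add: field_simps)
    then show "(9 / m) powr (- (1 / L)) \<le> exp 1" using m by (simp add: powr_def ln_div)
  qed auto
  also have "\<dots> \<le> 9 / m * 3" using exp_le by (intro mult_left_mono) auto
  finally have "cmod (1 - w) \<le> 27 / real a ^ 2" by (simp add: m_def)
  moreover have "cmod w < 1" unfolding w_def using z(2) by (rule h_lt)
  ultimately show thesis using that large by (simp add: P_def L_def)
qed

section \<open>Two constants arguments\<close>

lemma Re_of_real_divide:
  "Re (of_real k / (of_real k + z)) = k * (k + Re z) / ((k + Re z)\<^sup>2 + (Im z)\<^sup>2)"
  by (simp add: Re_divide)

text \<open>
  The real part of \<open>\<kappa> / (\<kappa> + (1 - z)) - 1 / 2\<close> is nonpositive outside \<open>ball 1 \<kappa>\<close> and at least \<open>1 / 6\<close> at \<open>w\<close>: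
  it takes the place of the harmonic measure of the arc.
\<close>

lemma ex_large_on_arc:
  fixes P :: "complex \<Rightarrow> complex" and \<kappa> M :: real
  assumes hol: "P holomorphic_on UNIV" and bound: "\<And>z. cmod z \<le> 1 \<Longrightarrow> cmod (P z) \<le> M"
    and \<kappa>: "0 < \<kappa>" and w: "cmod w \<le> 1" "cmod (1 - w) \<le> \<kappa> / 2" "P w \<noteq> 0"
  obtains u where "cmod u = 1" "cmod (1 - u) < \<kappa>" "M * (cmod (P w) / (2 * M)) ^ 3 \<le> cmod (P u)"
proof (rule ccontr)
  assume contr: "\<not> thesis"
  define p where "p = cmod (P w)"
  have p: "0 < p" "p \<le> M" using w bound[of w] by (simp_all add: p_def)
  then have M: "0 < M" by linarith
  \<comment> \<open>With \<open>exp l = 2 * M / p\<close>, the function \<open>f\<close> reaches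
    \<open>2 * M\<close> at \<open>w\<close>, although the maximum principle allows at most
    \<open>M\<close>.\<close>
  define l where "l = ln (2 * M / p)"
  have l: "0 \<le> l" using p by (simp add: l_def)
  have exp_l: "exp l = 2 * M / p" using p M by (simp add: l_def)
  define \<phi> where "\<phi> z = of_real \<kappa> / (of_real \<kappa> + (1 - z)) - 1 / 2" for z :: complex
  \<comment> \<open>The factor 6 turns \<open>1 / 6\<close> at \<open>w\<close> into the exponent
    \<open>l\<close>; the bound \<open>1 / 2\<close> on the disc becomes \<open>3 * l\<close>,
    whence the cube in the conclusion.\<close>
  define f where "f z = P z * exp (of_real (6 * l) * \<phi> z)" for z
  have Re0: "0 \<le> Re (1 - z)" if "cmod z \<le> 1" for z
    using that complex_Re_le_cmod[of z] by simp
  have nz: "of_real \<kappa> + (1 - z) \<noteq> 0" if "cmod z \<le> 1" for z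
    using Re0[OF that] \<kappa> by (auto simp: complex_eq_iff)
  have den: "0 < (\<kappa> + Re (1 - z))\<^sup>2 + (Im (1 - z))\<^sup>2" if "cmod z \<le> 1" for z
    using Re0[OF that] \<kappa> by (intro add_pos_nonneg) auto
  have Re_\<phi>: "Re (\<phi> z) = \<kappa> * (\<kappa> + Re (1 - z)) / ((\<kappa> + Re (1 - z))\<^sup>2 + (Im (1 - z))\<^sup>2) - 1 / 2" for z
    unfolding \<phi>_def minus_complex.sel(1) Re_of_real_divide by simp
  have norm_f: "cmod (f z) = cmod (P z) * exp (6 * l * Re (\<phi> z))" for z
    by (simp add: f_def norm_mult)
  have \<phi>_le: "Re (\<phi> z) \<le> 1 / 2" if z: "cmod z \<le> 1" for z
  proof -
    define a where "a = Re (1 - z)"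
    define b where "b = Im (1 - z)"
    have "0 \<le> a" using Re0[OF z] by (simp add: a_def)
    then have "\<kappa> * (\<kappa> + a) \<le> (\<kappa> + a)\<^sup>2 + b\<^sup>2"
      using \<kappa> by (simp add: power2_eq_square algebra_simps add_increasing2)
    moreover have "0 < (\<kappa> + a)\<^sup>2 + b\<^sup>2" using den[OF z] by (simp only: a_def b_def)
    ultimately have "\<kappa> * (\<kappa> + a) / ((\<kappa> + a)\<^sup>2 + b\<^sup>2) \<le> 1" by simp
    then show ?thesis by (simp only: Re_\<phi> a_def b_def)
  qed
  have \<phi>_far: "Re (\<phi> z) \<le> 0" if z: "cmod z \<le> 1" "\<kappa> \<le> cmod (1 - z)" for z
  proof -
    define a where "a = Re (1 - z)"
    define b where "b = Im (1 - z)"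
    have "\<kappa>\<^sup>2 \<le> (cmod (1 - z))\<^sup>2" using z(2) \<kappa> by (intro power_mono) auto
    then have "\<kappa>\<^sup>2 \<le> a\<^sup>2 + b\<^sup>2" by (simp add: cmod_power2 a_def b_def)
    then have "2 * (\<kappa> * (\<kappa> + a)) \<le> (\<kappa> + a)\<^sup>2 + b\<^sup>2"
      by (simp add: power2_eq_square algebra_simps)
    moreover have "0 < (\<kappa> + a)\<^sup>2 + b\<^sup>2" using den[OF z(1)] by (simp only: a_def b_def)
    ultimately have "\<kappa> * (\<kappa> + a) / ((\<kappa> + a)\<^sup>2 + b\<^sup>2) \<le> 1 / 2" by simp
    then show ?thesis by (simp only: Re_\<phi> a_def b_def)
  qed
  have \<phi>_w: "1 / 6 \<le> Re (\<phi> w)"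
  proof -
    define a where "a = Re (1 - w)"
    define b where "b = Im (1 - w)"
    have "a \<le> \<kappa> / 2" using w(2) complex_Re_le_cmod[of "1 - w"] by (simp add: a_def)
    then have a: "\<kappa> * a \<le> \<kappa> * (\<kappa> / 2)" using \<kappa> by (intro mult_left_mono) auto
    have "(cmod (1 - w))\<^sup>2 \<le> (\<kappa> / 2)\<^sup>2" using w(2) by (intro power_mono) auto
    then have "a\<^sup>2 + b\<^sup>2 \<le> (\<kappa> / 2)\<^sup>2" by (simp add: cmod_power2 a_def b_def)
    then have "2 * ((\<kappa> + a)\<^sup>2 + b\<^sup>2) \<le> 3 * (\<kappa> * (\<kappa> + a))"
      using a by (simp add: power2_eq_square algebra_simps)
    moreover have "0 < (\<kappa> + a)\<^sup>2 + b\<^sup>2" using den[OF w(1)] by (simp only: a_def b_def)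
    ultimately have "2 / 3 \<le> \<kappa> * (\<kappa> + a) / ((\<kappa> + a)\<^sup>2 + b\<^sup>2)" by (simp add: le_divide_eq)
    then have "1 / 6 \<le> \<kappa> * (\<kappa> + a) / ((\<kappa> + a)\<^sup>2 + b\<^sup>2) - 1 / 2" by linarith
    then show ?thesis by (simp only: Re_\<phi> a_def b_def)
  qed
  have "cmod (f w) \<le> M"
  proof (rule maximum_modulus_frontier[of f "cball 0 1"])
    have hol_f: "f holomorphic_on cball 0 1"
      unfolding f_def \<phi>_def using nz
      by (intro holomorphic_intros holomorphic_on_subset[OF hol]) auto
    then show "f holomorphic_on interior (cball 0 1)"
      by (rule holomorphic_on_subset) (rule interior_subset)
    show "continuous_on (closure (cball 0 1)) f"
      using holomorphic_on_imp_continuous_on[OF hol_f] by simp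
    fix z :: complex assume "z \<in> frontier (cball 0 1)"
    then have z: "cmod z = 1" by simp
    show "cmod (f z) \<le> M"
    proof (cases "cmod (1 - z) < \<kappa>")
      case True
      then have "cmod (P z) < M * (p / (2 * M)) ^ 3"
        using contr that[of z] z by (force simp: p_def)
      moreover have "exp (6 * l * Re (\<phi> z)) \<le> exp (3 * l)"
        using mult_left_mono[OF \<phi>_le[of z], of "6 * l"] z l by simp
      ultimately have "cmod (f z) \<le> M * (p / (2 * M)) ^ 3 * exp (3 * l)"
        unfolding norm_f using M p by (intro mult_mono) auto
      also have "exp (3 * l) = (2 * M / p) ^ 3"
        using exp_of_nat_mult[of 3 l] by (simp add: exp_l)
      also have "M * (p / (2 * M)) ^ 3 * (2 * M / p) ^ 3 = M"
        using p M by (simp add: power_divide)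
      finally show ?thesis .
    next
      case False
      then have "6 * l * Re (\<phi> z) \<le> 0" using \<phi>_far[of z] z l by (simp add: mult_nonneg_nonpos)
      then have "cmod (P z) * exp (6 * l * Re (\<phi> z)) \<le> M * 1"
        using bound[of z] z M by (intro mult_mono) auto
      then show ?thesis by (simp add: norm_f)
    qed
  qed (use w in auto)
  moreover have "2 * M \<le> cmod (f w)"
  proof -
    have "p * exp l \<le> p * exp (6 * l * Re (\<phi> w))"
      using p mult_left_mono[OF \<phi>_w, of "6 * l"] l by simp
    then show ?thesis using p by (simp add: norm_f exp_l p_def)
  qed
  ultimately show False using M by simp
qed

text \<open>
  The maximum principle for \<open>f / b ^ k\<close> outside a small disc around \<open>q\<close>, where \<open>b\<close> is the Blaschke factor
  of the disc of radius \<open>(1 + q) / 2\<close> with zero at \<open>q\<close>.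
\<close>

lemma ex_large_near:
  fixes f :: "complex \<Rightarrow> complex" and q M :: real and k :: nat
  assumes hol: "f holomorphic_on UNIV" and q: "0 < q" "q < 1"
    and bound: "\<And>z. cmod z \<le> (1 + q) / 2 \<Longrightarrow> cmod (f z) \<le> M"
    and k: "M < cmod (f 0) * ((1 + q) / (2 * q)) ^ k"
  obtains z where "cmod (z - of_real q) \<le> 1 - q" "M * (q * (1 - q) / 8) ^ k \<le> cmod (f z)"
proof (rule ccontr)
  assume contr: "\<not> thesis"
  define R where "R = (1 + q) / 2"
  \<comment> \<open>Small enough for 0 to lie outside the removed disc and for this disc to lie in
    the region claimed for \<open>z\<close>. On its boundary
    \<open>\<rho> / 2 \<le> cmod (b z)\<close>, which explains
    \<open>q * (1 - q) / 8\<close>.\<close>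
  define \<rho> where "\<rho> = q * (1 - q) / 4"
  have R: "q < R" "R < 1" "0 < R" using q by (simp_all add: R_def)
  have "q * (1 - q) \<le> 1 * (1 - q)" "q * (1 - q) \<le> q * 1" "0 < q * (1 - q)"
    using q by (intro mult_mono mult_pos_pos; simp)+
  then have "4 * \<rho> \<le> 1 - q" "4 * \<rho> \<le> q" "0 < \<rho>" by (simp_all add: \<rho>_def)
  then have \<rho>: "0 < \<rho>" "\<rho> \<le> q" "\<rho> \<le> 1 - q" by simp_all
  have M: "0 \<le> M" using order_trans[OF norm_ge_zero bound[of 0]] q by simp
  define b where "b z = of_real R * (z - of_real q) / (of_real (R\<^sup>2) - of_real q * z)" for z :: complex
  define g where "g z = f z / b z ^ k" for z
  define S where "S = cball (0::complex) R \<inter> - ball (of_real q) \<rho>"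
  have den: "of_real (R\<^sup>2) - of_real q * z \<noteq> (0::complex)" if "cmod z \<le> R" for z
  proof
    assume "of_real (R\<^sup>2) - of_real q * z = 0"
    then have "cmod (of_real q * z) = cmod (of_real (R\<^sup>2) :: complex)" by simp
    then have "q * cmod z = R\<^sup>2" unfolding norm_mult norm_of_real using q by simp
    moreover have "q * cmod z \<le> q * R" using that q by (intro mult_left_mono) auto
    moreover have "q * R < R * R" using R by simp
    ultimately show False by (simp add: power2_eq_square)
  qed
  have out: "\<rho> \<le> cmod (z - of_real q)" if "z \<in> S" for z
    using that by (auto simp: S_def dist_norm norm_minus_commute)
  have b_nz: "b z \<noteq> 0" if "z \<in> S" for z
    using out[OF that] \<rho>(1) R den[of z] that by (auto simp: b_def S_def)
  have hol_g: "g holomorphic_on S"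
    unfolding g_def
  proof (intro holomorphic_intros)
    show "f holomorphic_on S" using hol by (rule holomorphic_on_subset) simp
    show "b holomorphic_on S"
      unfolding b_def using den by (intro holomorphic_intros) (auto simp: S_def)
  qed (use b_nz in auto)
  have clS: "closed S" unfolding S_def by (intro closed_Int closed_cball closed_Compl open_ball)
  have "cmod (g 0) \<le> M"
  proof (rule maximum_modulus_frontier[of g S])
    show "g holomorphic_on interior S" using hol_g by (rule holomorphic_on_subset) (rule interior_subset)
    show "continuous_on (closure S) g"
      using holomorphic_on_imp_continuous_on[OF hol_g] clS by simp
    show "bounded S" unfolding S_def by (intro bounded_Int) auto
    show "0 \<in> S" using \<rho> R by (simp add: S_def)
    fix z assume z: "z \<in> frontier S"
    then have zS: "z \<in> S" using clS frontier_subset_closed by blast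
    have "z \<in> frontier (cball 0 R) \<union> frontier (- ball (of_real q) \<rho>)"
      using z frontier_Int_subset unfolding S_def by blast
    then consider "cmod z = R" | "cmod (z - of_real q) = \<rho>"
      using \<rho> by (auto simp: frontier_complement dist_norm norm_minus_commute)
    then show "cmod (g z) \<le> M"
    proof cases
      case 1
      have "(R * cmod (z - of_real q))\<^sup>2 = (cmod (of_real (R\<^sup>2) - of_real q * z))\<^sup>2"
      proof -
        have "(Re z)\<^sup>2 + (Im z)\<^sup>2 = R\<^sup>2" using 1 by (simp add: cmod_power2[symmetric])
        then have Im: "(Im z)\<^sup>2 = R\<^sup>2 - (Re z)\<^sup>2" by simp
        have 1: "(R * cmod (z - of_real q))\<^sup>2 = R\<^sup>2 * ((Re z - q)\<^sup>2 + (Im z)\<^sup>2)"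
          by (simp add: power_mult_distrib cmod_power2)
        have 2: "(cmod (of_real (R\<^sup>2) - of_real q * z))\<^sup>2 = (R\<^sup>2 - q * Re z)\<^sup>2 + q\<^sup>2 * (Im z)\<^sup>2"
          by (simp add: power_mult_distrib cmod_power2 del: of_real_power)
        show ?thesis unfolding 1 2 Im by (simp add: power2_eq_square algebra_simps)
      qed
      then have "R * cmod (z - of_real q) = cmod (of_real (R\<^sup>2) - of_real q * z)"
        using R by (simp add: power2_eq_iff_nonneg)
      then have "cmod (b z) = 1"
        using den[of z] 1 R by (simp add: b_def norm_mult norm_divide del: of_real_power)
      then show ?thesis using bound[of z] 1 by (simp add: g_def norm_divide norm_power R_def)
    next
      case 2
      have "cmod (of_real (R\<^sup>2) - of_real q * z) \<le> R\<^sup>2 + q * cmod z"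
        using norm_triangle_ineq4[of "of_real (R\<^sup>2)" "of_real q * z"] q
        by (simp only: norm_mult norm_of_real) (simp add: abs_of_pos)
      also have "\<dots> \<le> R * R + R * R"
        using zS R q by (intro add_mono mult_mono) (auto simp: S_def power2_eq_square)
      also have "\<dots> \<le> R * 2" using R by (simp add: mult_left_mono)
      finally have le: "cmod (of_real (R\<^sup>2) - of_real q * z) \<le> R * 2" .
      have pos: "0 < cmod (of_real (R\<^sup>2) - of_real q * z)" using den[of z] zS by (auto simp: S_def)
      have "cmod (b z) = R * \<rho> / cmod (of_real (R\<^sup>2) - of_real q * z)"
        using 2 R by (simp add: b_def norm_mult norm_divide del: of_real_power)
      moreover have "R * \<rho> / (R * 2) \<le> R * \<rho> / cmod (of_real (R\<^sup>2) - of_real q * z)"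
        using le pos R \<rho> by (intro divide_left_mono) auto
      ultimately have "\<rho> / 2 \<le> cmod (b z)" using R by simp
      then have "(\<rho> / 2) ^ k \<le> cmod (b z) ^ k" using \<rho> by (intro power_mono) auto
      then have "M * (\<rho> / 2) ^ k \<le> M * cmod (b z) ^ k" using M by (rule mult_left_mono)
      moreover have "cmod (f z) < M * (\<rho> / 2) ^ k"
        using contr that[of z] 2 \<rho>(3) by (force simp: \<rho>_def)
      ultimately have "cmod (f z) \<le> M * cmod (b z) ^ k" by linarith
      moreover have "0 < cmod (b z) ^ k" using b_nz[OF zS] by simp
      ultimately show ?thesis by (simp add: g_def norm_divide norm_power divide_le_eq)
    qed
  qed
  \<comment> \<open>The reciprocal is the base \<open>(1 + q) / (2 * q)\<close> in the hypothesis on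
    \<open>k\<close>.\<close>
  moreover have "cmod (b 0) = q / R"
    using R q by (simp add: b_def norm_divide norm_mult power2_eq_square)
  then have "cmod (g 0) = cmod (f 0) * (R / q) ^ k"
    by (simp add: g_def norm_divide norm_power power_divide)
  moreover have "R / q = (1 + q) / (2 * q)" by (simp add: R_def)
  ultimately show False using k by simp
qed

section \<open>Separation of trace laws\<close>

text \<open>Conditioning on the fate of each letter of the common prefix \<open>v\<close> gives both
  means the same weights. Hence padding does not change the distance of laws that appears in the
  bound.\<close>

lemma norm_trace_mean_diff_le:
  fixes f :: "bool list \<Rightarrow> complex"
  assumes q: "0 \<le> q" "q \<le> 1" and len: "length x = n" "length y = n"
    and f: "\<And>w. length w \<le> length v + n \<Longrightarrow> cmod (f w) \<le> S"
  shows "cmod (trace_mean q (v @ x) f - trace_mean q (v @ y) f) \<le>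
     S * (\<Sum>w\<in>words_upto n. \<bar>trace_law q x w - trace_law q y w\<bar>)"
  using f
proof (induction v arbitrary: f)
  case Nil
  have "trace_mean q x f - trace_mean q y f =
     (\<Sum>w\<in>words_upto n. of_real (trace_law q x w - trace_law q y w) * f w)"
    by (simp add: trace_mean_def len sum_subtractf algebra_simps)
  also have "cmod \<dots> \<le> (\<Sum>w\<in>words_upto n. \<bar>trace_law q x w - trace_law q y w\<bar> * S)"
  proof (rule sum_norm_le)
    fix w assume "w \<in> words_upto n"
    then have "cmod (f w) \<le> S" using Nil by (simp add: words_upto_def)
    then show "cmod (of_real (trace_law q x w - trace_law q y w) * f w) \<le>
       \<bar>trace_law q x w - trace_law q y w\<bar> * S"
      unfolding norm_mult norm_of_real by (rule mult_left_mono) simp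
  qed
  finally show ?case by (simp add: sum_distrib_left mult.commute)
next
  case (Cons c v)
  let ?t = "\<Sum>w\<in>words_upto n. \<bar>trace_law q x w - trace_law q y w\<bar>"
  let ?d = "\<lambda>f. trace_mean q (v @ x) f - trace_mean q (v @ y) f"
  have "trace_mean q ((c # v) @ x) f - trace_mean q ((c # v) @ y) f =
     of_real q * ?d f + of_real (1 - q) * ?d (\<lambda>w. f (c # w))"
    by (simp add: algebra_simps)
  also have "cmod \<dots> \<le> cmod (of_real q * ?d f) + cmod (of_real (1 - q) * ?d (\<lambda>w. f (c # w)))"
    by (rule norm_triangle_ineq)
  also have "\<dots> \<le> q * (S * ?t) + (1 - q) * (S * ?t)"
    unfolding norm_mult norm_of_real using q
    by (intro add_mono mult_mono Cons.IH) (auto intro!: Cons.prems)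
  finally show ?case by (simp add: algebra_simps)
qed

text \<open>
  The bound is quadratic in \<open>cmod (1 - u)\<close> since the disc of centre \<open>q\<close> and radius \<open>1 - q\<close> is tangent to
  the unit circle at \<open>1\<close>.
\<close>

lemma norm_shifted_unit_le:
  assumes u: "cmod u = 1" and q: "q < 1"
  shows "cmod ((u - of_real q) / of_real (1 - q)) \<le> exp ((cmod (1 - u) / (1 - q))\<^sup>2 / 2)"
proof (rule power2_le_imp_le)
  define s where "s = 1 - q"
  have s: "0 < s" "q = 1 - s" using q by (simp_all add: s_def)
  have "(Re u)\<^sup>2 + (Im u)\<^sup>2 = 1" using u by (simp add: cmod_power2[symmetric])
  then have Im: "(Im u)\<^sup>2 = 1 - (Re u)\<^sup>2" by simp
  have "(cmod (u - of_real q))\<^sup>2 = (Re u - q)\<^sup>2 + (Im u)\<^sup>2"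
    by (simp add: cmod_power2)
  also have "\<dots> = s\<^sup>2 - 2 * s * (1 - Re u) + ((1 - Re u)\<^sup>2 + (Im u)\<^sup>2)"
    unfolding s(2) by (simp add: power2_eq_square algebra_simps)
  also have "(1 - Re u)\<^sup>2 + (Im u)\<^sup>2 = (cmod (1 - u))\<^sup>2"
    by (simp add: cmod_power2)
  also have "s\<^sup>2 - 2 * s * (1 - Re u) + (cmod (1 - u))\<^sup>2 \<le> s\<^sup>2 + (cmod (1 - u))\<^sup>2"
    using s complex_Re_le_cmod[of u] u by simp
  finally have "(cmod (u - of_real q))\<^sup>2 \<le> s\<^sup>2 + (cmod (1 - u))\<^sup>2" .
  then have "(cmod (u - of_real q) / s)\<^sup>2 \<le> 1 + (cmod (1 - u) / s)\<^sup>2"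
    using s(1) by (simp add: power_divide field_simps)
  also have "\<dots> \<le> exp ((cmod (1 - u) / s)\<^sup>2)" by (rule exp_ge_add_one_self)
  also have "\<dots> = (exp ((cmod (1 - u) / s)\<^sup>2 / 2))\<^sup>2"
    by (simp add: power2_eq_square flip: exp_add)
  finally have "(cmod (u - of_real q) / s)\<^sup>2 \<le> (exp ((cmod (1 - u) / s)\<^sup>2 / 2))\<^sup>2" .
  moreover have "cmod ((u - of_real q) / of_real s) = cmod (u - of_real q) / s"
    unfolding norm_divide norm_of_real using s by simp
  ultimately show "(cmod ((u - of_real q) / of_real (1 - q)))\<^sup>2 \<le> (exp ((cmod (1 - u) / (1 - q))\<^sup>2 / 2))\<^sup>2"
    unfolding s_def by simp
qed simp

lemma ex_power_gt:
  fixes c M p :: real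
  assumes "1 < c" "1 \<le> M" "0 < p" "p \<le> 1"
  obtains k :: nat where "M < p * c ^ k" "k \<le> ln (M / p) / ln c + 2"
proof
  \<comment> \<open>One unit of the final \<open>2\<close> comes from the ceiling, the other makes
    the inequality strict.\<close>
  define k where "k = nat \<lceil>ln (M / p) / ln c\<rceil> + 1"
  have "0 \<le> ln (M / p) / ln c" using assms by (simp add: divide_nonneg_nonneg)
  then have k: "ln (M / p) / ln c < k" "k \<le> ln (M / p) / ln c + 2"
    unfolding k_def by linarith+
  show "k \<le> ln (M / p) / ln c + 2" by (rule k(2))
  have "ln (M / p) < k * ln c" using k(1) assms by (simp add: pos_divide_less_eq)
  also have "\<dots> = ln (c ^ k)" using assms by (simp add: ln_realpow)
  finally have "M / p < c ^ k" using assms by (subst (asm) ln_less_cancel_iff) auto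
  then show "M < p * c ^ k" using assms by (simp add: field_simps)
qed

text \<open>
  Both strings are padded in front by \<open>2 * a\<close> known letters, so that the first difference is preceded by
  enough letters.
\<close>

lemma trace_law_separation_aux:
  fixes q N E :: real and a n :: nat
  assumes q: "0 < q" "q < 1" and a: "2 \<le> a" "n \<le> a ^ 5"
    and len: "length x = n" "length y = n" and ne: "x \<noteq> y"
    and N_def: "N = 3 * real a ^ 5"
    and E_def: "E = 1 + 10 * (8 * a * (ln N)\<^sup>2 + 1) * ln N"
  shows "\<exists>k::nat. k \<le> (ln (2 * N) + (2 * a + 1) * ln (2 / (1 - q)) + 3 * E + ln (8 * (N + 2)\<^sup>2)) /
        ln ((1 + q) / (2 * q)) + 2 \<and>
     (1 - q) ^ (2 * a + 1) * (q * (1 - q) / 8) ^ k \<le>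
       exp (4374 / (1 - q)\<^sup>2 * a) * (N + 1) ^ (2 * a + 2) *
         (\<Sum>w\<in>words_upto n. \<bar>trace_law q x w - trace_law q y w\<bar>)"
proof -
  define t where "t = (\<Sum>w\<in>words_upto n. \<bar>trace_law q x w - trace_law q y w\<bar>)"
  define pre where "pre = replicate (2 * a) False"
  \<comment> \<open>The padded length; \<open>N = 3 * a ^ 5\<close> dominates it.\<close>
  define n' where "n' = 2 * a + n"
  have ra: "2 \<le> real a" using a by simp
  have a5: "real a ^ 2 \<le> real a ^ 5" "real a \<le> real a ^ 5"
    using power_increasing[of 2 5 "real a"] power_increasing[of 1 5 "real a"] ra by auto
  have "real n \<le> real a ^ 5" using a(2) by (metis of_nat_le_iff of_nat_power)
  then have n'N: "real n' \<le> N" using a5 \<open>real n \<le> _\<close> unfolding n'_def N_def of_nat_add of_nat_mult of_nat_numeral by linarith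
  have a2N: "real a ^ 2 \<le> N" unfolding N_def using a5(1) zero_le_power[of "real a" 5] by linarith
  have "2\<^sup>2 \<le> real a ^ 2" using ra by (intro power_mono) auto
  then have N4: "4 \<le> N" using a2N by simp
  have "length x = length y" using len by simp
  from same_length_different[OF ne this]
  obtain v b xs b' ys where b: "b \<noteq> b'" and xy: "x = v @ [b] @ xs" "y = v @ [b'] @ ys" by blast
  have "b' = (\<not> b)" using b by simp
  then have split: "pre @ x = (pre @ v) @ b # xs" "pre @ y = (pre @ v) @ (\<not> b) # ys"
    unfolding xy by simp_all
  have len': "length (pre @ x) = length (pre @ y)" "length (pre @ x) = n'" "length (pre @ y) = n'"
    using len by (simp_all add: pre_def n'_def)
  have "2 * a \<le> length (pre @ v)" by (simp add: pre_def)
  note occs = separated_occs_diff[OF len'(1) this split, unfolded len'(2)]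
  obtain w \<sigma> m \<eta> d c where w: "length w = Suc (2 * a)" and \<sigma>: "\<sigma> = 1 \<or> \<sigma> = -1"
    and \<eta>: "\<eta> = 0 \<or> \<eta> = 1" and d: "1 \<le> d" and c: "\<And>j. cmod (c j) \<le> 1"
    and diff: "\<And>u. occ_gf u 0 w (pre @ x) - occ_gf u 0 w (pre @ y) =
       \<sigma> * u ^ m * (1 - \<eta> * u ^ d + u ^ a * (\<Sum>j<n'. c j * u ^ j))"
    by (rule occs) (rule that)
  define Q where "Q u = (\<Sum>j<n'. c j * u ^ j)" for u
  define P where "P u = 1 - \<eta> * u ^ d + u ^ a * Q u" for u
  have Q_hol: "Q holomorphic_on UNIV" unfolding Q_def by (intro holomorphic_intros)
  have Q_le: "cmod (Q u) \<le> N" if "cmod u \<le> 1" for u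
  proof -
    have "cmod (Q u) \<le> (\<Sum>j<n'. 1)"
      unfolding Q_def using c that
      by (intro sum_norm_le) (simp add: norm_mult norm_power mult_le_one power_le_one)
    also have "\<dots> \<le> N" using n'N by simp
    finally show ?thesis .
  qed
  have \<eta>1: "cmod \<eta> \<le> 1" using \<eta> by auto
  have P_hol: "P holomorphic_on UNIV" unfolding P_def using Q_hol by (intro holomorphic_intros)
  have P_le: "cmod (P u) \<le> N + 2" if "cmod u \<le> 1" for u
  proof -
    have "cmod (P u) \<le> cmod (1 - \<eta> * u ^ d) + cmod (u ^ a * Q u)"
      unfolding P_def by (rule norm_triangle_ineq)
    also have "\<dots> \<le> (cmod 1 + cmod (\<eta> * u ^ d)) + cmod (u ^ a * Q u)"
      by (intro add_mono norm_triangle_ineq4 order_refl)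
    also have "\<dots> \<le> (1 + 1 * 1) + 1 * N"
      unfolding norm_mult norm_power using \<eta>1 that Q_le[of u]
      by (intro add_mono mult_mono power_le_one) auto
    finally show ?thesis by simp
  qed
  note disc = ex_large_value_in_disc[OF Q_hol Q_le \<eta>1 d a(1) a2N, folded P_def E_def]
  obtain w0 where w0: "cmod w0 < 1" "cmod (1 - w0) \<le> 27 / real a ^ 2" "exp (- E) \<le> cmod (P w0)"
    by (rule disc) (assumption, rule that)
  have P_w0: "P w0 \<noteq> 0"
  proof
    assume "P w0 = 0"
    with w0(3) show False by simp
  qed
  have "0 < 54 / real a ^ 2" "cmod (1 - w0) \<le> 54 / real a ^ 2 / 2" using ra w0(2) by simp_all
  note arc = ex_large_on_arc[OF P_hol P_le this(1) less_imp_le[OF w0(1)] this(2) P_w0]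
  obtain u where u: "cmod u = 1" "cmod (1 - u) < 54 / real a ^ 2"
    "(N + 2) * (cmod (P w0) / (2 * (N + 2))) ^ 3 \<le> cmod (P u)"
    by (rule arc) (assumption, rule that)
  \<comment> \<open>The lower bound on the arc with \<open>exp (- E)\<close> for
    \<open>cmod (P w0)\<close>, written as an exponential so that \<open>ln p\<close> is
    explicit.\<close>
  define p where "p = exp (- (3 * E + ln (8 * (N + 2)\<^sup>2)))"
  have "p = (N + 2) * (exp (- E) / (2 * (N + 2))) ^ 3"
  proof -
    have "exp (- (3 * E)) = exp (- E) ^ 3" using exp_of_nat_mult[of 3 "- E"] by simp
    moreover have "p = exp (- (3 * E)) / exp (ln (8 * (N + 2)\<^sup>2))"
      unfolding p_def by (simp add: exp_diff[symmetric])
    moreover have "exp (ln (8 * (N + 2)\<^sup>2)) = 8 * (N + 2)\<^sup>2" using N4 by (intro exp_ln) simp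
    ultimately have "p = exp (- E) ^ 3 / (8 * (N + 2)\<^sup>2)" by (simp only:)
    also have "\<dots> = (N + 2) * (exp (- E) / (2 * (N + 2))) ^ 3"
      using N4 unfolding power_divide power_mult_distrib by (simp add: power2_eq_square power3_eq_cube)
    finally show ?thesis .
  qed
  also have "\<dots> \<le> (N + 2) * (cmod (P w0) / (2 * (N + 2))) ^ 3"
    using N4 w0(3) by (intro mult_left_mono power_mono divide_right_mono) auto
  finally have pu: "p \<le> cmod (P u)" using u(3) by linarith
  define f where "f z = occ_gf u z w (pre @ x) - occ_gf u z w (pre @ y)" for z
  have f_hol: "f holomorphic_on UNIV" unfolding f_def by (intro holomorphic_intros)
  have "cmod (f 0) = cmod (P u)"
    using \<sigma> u(1) by (auto simp: f_def diff P_def Q_def norm_mult norm_power)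
  then have f0: "p \<le> cmod (f 0)" using pu by simp
  define g where "g = 2 / (1 - q)"
  define M where "M = 2 * N * g ^ (2 * a + 1)"
  have g: "1 \<le> g" using q by (simp add: g_def)
  have M1: "1 \<le> M"
  proof -
    have "1 * 1 \<le> 2 * N * g ^ (2 * a + 1)" using N4 g by (intro mult_mono one_le_power) auto
    then show ?thesis by (simp add: M_def)
  qed
  have f_le: "cmod (f z) \<le> M" if "cmod z \<le> (1 + q) / 2" for z
  proof -
    have g': "1 / (1 - (1 + q) / 2) = g" using q by (simp add: g_def field_simps)
    have *: "cmod (occ_gf u z w s) \<le> N * g ^ (2 * a + 1)" if "length s = n'" for s
    proof -
      have "cmod (occ_gf u z w s) \<le> real (length s) * (1 / (1 - (1 + q) / 2)) ^ length w"
        using \<open>cmod z \<le> _\<close> q u(1) by (intro norm_occ_gf_le_geometric) auto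
      also have "\<dots> \<le> N * g ^ (2 * a + 1)"
        unfolding g' w that using n'N g by (simp add: mult_right_mono del: power_Suc)
      finally show ?thesis .
    qed
    have "cmod (f z) \<le> cmod (occ_gf u z w (pre @ x)) + cmod (occ_gf u z w (pre @ y))"
      unfolding f_def by (rule norm_triangle_ineq4)
    also have "\<dots> \<le> N * g ^ (2 * a + 1) + N * g ^ (2 * a + 1)"
      by (intro add_mono * len')
    finally show ?thesis by (simp add: M_def)
  qed
  have "0 \<le> ln (8 * (N + 2)\<^sup>2)"
  proof (rule ln_ge_zero)
    have "1 * 1 \<le> 8 * (N + 2)\<^sup>2" using N4 by (intro mult_mono one_le_power) auto
    then show "1 \<le> 8 * (N + 2)\<^sup>2" by simp
  qed
  moreover have "0 \<le> E"
    unfolding E_def using N4 by (intro add_nonneg_nonneg mult_nonneg_nonneg ln_ge_zero) auto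
  ultimately have p: "0 < p" "p \<le> 1" by (simp_all add: p_def)
  have "1 < (1 + q) / (2 * q)" using q by simp
  from ex_power_gt[OF this M1 p]
  obtain k where k: "M < p * ((1 + q) / (2 * q)) ^ k" "k \<le> ln (M / p) / ln ((1 + q) / (2 * q)) + 2" .
  have "M < cmod (f 0) * ((1 + q) / (2 * q)) ^ k"
  proof -
    have "p * ((1 + q) / (2 * q)) ^ k \<le> cmod (f 0) * ((1 + q) / (2 * q)) ^ k"
      using f0 q by (intro mult_right_mono) auto
    then show ?thesis using k(1) by linarith
  qed
  from ex_large_near[OF f_hol q f_le this]
  obtain z where z: "cmod (z - of_real q) \<le> 1 - q" "M * (q * (1 - q) / 8) ^ k \<le> cmod (f z)" .
  \<comment> \<open>Preimages of \<open>z\<close> and \<open>u\<close> under the affine change of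
    variables in \<open>trace_mean_occ_gf\<close>: the statistic is evaluated there on traces. The
    radius \<open>1 - q\<close> around \<open>q\<close> is what makes
    \<open>cmod \<zeta> \<le> 1\<close>.\<close>
  define \<zeta> where "\<zeta> = (z - of_real q) / of_real (1 - q)"
  define \<zeta>0 where "\<zeta>0 = (u - of_real q) / of_real (1 - q)"
  have q1: "complex_of_real (1 - q) \<noteq> 0" using q by simp
  have z_eq: "of_real q + (1 - of_real q) * \<zeta> = z" "of_real q + (1 - of_real q) * \<zeta>0 = u"
    using q1 by (simp_all add: \<zeta>_def \<zeta>0_def)
  have \<zeta>: "cmod \<zeta> \<le> 1" unfolding \<zeta>_def norm_divide norm_of_real using z(1) q by simp
  define B where "B = exp ((54 / real a ^ 2 / (1 - q))\<^sup>2 / 2)"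
  have B1: "1 \<le> B" by (simp add: B_def)
  have \<zeta>0: "cmod \<zeta>0 \<le> B"
  proof -
    have "(cmod (1 - u) / (1 - q))\<^sup>2 \<le> (54 / real a ^ 2 / (1 - q))\<^sup>2"
      using u(2) q by (intro power_mono divide_right_mono) auto
    then have "exp ((cmod (1 - u) / (1 - q))\<^sup>2 / 2) \<le> B" unfolding B_def by simp
    with norm_shifted_unit_le[OF u(1) q(2)] show ?thesis
      unfolding \<zeta>0_def by (rule order_trans)
  qed
  define S where "S = B ^ n' * (N + 1) ^ (2 * a + 2)"
  have "cmod (trace_mean q (pre @ x) (occ_gf \<zeta>0 \<zeta> w) - trace_mean q (pre @ y) (occ_gf \<zeta>0 \<zeta> w)) \<le> S * t"
    unfolding t_def
  proof (rule norm_trace_mean_diff_le)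
    fix s :: "bool list" assume "length s \<le> length pre + n"
    then have s: "length s \<le> n'" by (simp add: pre_def n'_def)
    have "cmod (occ_gf \<zeta>0 \<zeta> w s) \<le> B ^ length s * (real (length s) + 1) ^ Suc (length w)"
      using \<zeta> B1 \<zeta>0 by (rule norm_occ_gf_le_power)
    also have "\<dots> \<le> S"
      unfolding S_def w using B1 s n'N N4
      by (intro mult_mono power_increasing order_trans[OF power_mono power_increasing]) auto
    finally show "cmod (occ_gf \<zeta>0 \<zeta> w s) \<le> S" .
  qed (use q len in auto)
  also have "trace_mean q (pre @ x) (occ_gf \<zeta>0 \<zeta> w) - trace_mean q (pre @ y) (occ_gf \<zeta>0 \<zeta> w) =
     of_real ((1 - q) ^ (2 * a + 1)) * f z"
    unfolding trace_mean_occ_gf z_eq by (simp add: w f_def algebra_simps)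
  finally have St: "(1 - q) ^ (2 * a + 1) * cmod (f z) \<le> S * t"
    unfolding norm_mult norm_of_real using q by simp
  have t0: "0 \<le> t" unfolding t_def by (intro sum_nonneg) auto
  have "1 * (q * (1 - q) / 8) ^ k \<le> M * (q * (1 - q) / 8) ^ k"
    using M1 q by (intro mult_right_mono) auto
  then have "(q * (1 - q) / 8) ^ k \<le> cmod (f z)" using z(2) by linarith
  then have "(1 - q) ^ (2 * a + 1) * (q * (1 - q) / 8) ^ k \<le> (1 - q) ^ (2 * a + 1) * cmod (f z)"
    using q by (intro mult_left_mono) auto
  also have "\<dots> \<le> S * t" by (rule St)
  also have "\<dots> \<le> exp (4374 / (1 - q)\<^sup>2 * a) * (N + 1) ^ (2 * a + 2) * t"
  proof -
    \<comment> \<open>A length of order \<open>a ^ 5\<close> meets an exponent of order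
      \<open>1 / a ^ 4\<close>. The result is linear in \<open>a\<close>, which is the origin of the
      fifth root; \<open>4374\<close> is half of 3 times 54 squared.\<close>
    have "B ^ n' = exp (n' * ((54 / real a ^ 2 / (1 - q))\<^sup>2 / 2))"
      unfolding B_def by (simp only: exp_of_nat_mult)
    also have "\<dots> \<le> exp (N * ((54 / real a ^ 2 / (1 - q))\<^sup>2 / 2))"
      using n'N by (simp add: mult_right_mono)
    also have "N * ((54 / real a ^ 2 / (1 - q))\<^sup>2 / 2) = 4374 / (1 - q)\<^sup>2 * a"
    proof -
      have "(54 / real a ^ 2 / (1 - q))\<^sup>2 = 2916 / (real a ^ 4 * (1 - q)\<^sup>2)"
        by (simp add: power_divide power_mult_distrib flip: power_mult)
      moreover have "real a ^ 5 = real a ^ 4 * real a" by (simp add: eval_nat_numeral)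
      moreover have "real a ^ 4 \<noteq> 0" using ra by simp
      ultimately show ?thesis unfolding N_def by simp
    qed
    finally show ?thesis unfolding S_def using N4 t0 by (intro mult_right_mono) auto
  qed
  finally have main: "(1 - q) ^ (2 * a + 1) * (q * (1 - q) / 8) ^ k \<le>
     exp (4374 / (1 - q)\<^sup>2 * a) * (N + 1) ^ (2 * a + 2) * t" .
  have "ln (M / p) = ln (2 * N) + (2 * a + 1) * ln (2 / (1 - q)) + 3 * E + ln (8 * (N + 2)\<^sup>2)"
  proof -
    have "ln (M / p) = ln M - ln p" using M1 p by (simp add: ln_div)
    also have "ln M = ln (2 * N) + ln (g ^ (2 * a + 1))"
      unfolding M_def using N4 g by (intro ln_mult_pos) auto
    also have "ln (g ^ (2 * a + 1)) = (2 * a + 1) * ln g" using g by (subst ln_realpow) auto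
    finally show ?thesis by (simp add: p_def g_def)
  qed
  then show ?thesis using k(2) main unfolding t_def by (intro exI[of _ k]) simp
qed

text \<open>Every term of the explicit inequality is compared with \<open>Y = a * ln a ^ 3\<close>;
  the order of \<open>Y\<close> is that of \<open>E\<close>, which enters through
  \<open>k\<close>.\<close>

lemma trace_law_separation:
  fixes q :: real
  assumes q: "0 < q" "q < 1"
  shows "\<exists>C>0. \<forall>a n x y. 2 \<le> a \<longrightarrow> n \<le> a ^ 5 \<longrightarrow> length x = n \<longrightarrow> length y = n \<longrightarrow> x \<noteq> y \<longrightarrow>
     exp (- (C * (real a * ln (real a) ^ 3))) \<le>
       (\<Sum>w\<in>words_upto n. \<bar>trace_law q x w - trace_law q y w\<bar>)"
proof -
  define g where "g = ln (2 / (1 - q))"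
  define r where "r = ln ((1 + q) / (2 * q))"
  define s where "s = - ln (1 - q)"
  define \<rho> where "\<rho> = q * (1 - q) / 8"
  define b where "b = 4374 / (1 - q)\<^sup>2"
  \<comment> \<open>Makes \<open>k \<le> c * Y\<close>: here \<open>84224\<close> is
    \<open>3 * 28000 + 8 * 28\<close>, from \<open>3 * E\<close> and the logarithms, and the last 8
    absorbs the additive \<open>2\<close>.\<close>
  define c where "c = (84224 + 12 * g) / r + 8"
  \<comment> \<open>The summands pay for \<open>(1 - q) ^ (2 * a + 1)\<close>,
    \<open>\<rho> ^ k\<close>, \<open>exp (b * a)\<close> and \<open>(N + 1) ^ (2 * a + 2)\<close>
    in turn.\<close>
  define C where "C = 12 * s + c * (- ln \<rho>) + 4 * b + 168"
  have "q * (1 - q) \<le> 1 * 1" using q by (intro mult_mono) auto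
  then have \<rho>: "0 < \<rho>" "\<rho> < 1" using q by (simp_all add: \<rho>_def)
  have g: "0 \<le> g" unfolding g_def using q by (intro ln_ge_zero) simp
  have r: "0 < r" unfolding r_def using q by (intro ln_gt_zero) simp
  have s: "0 < s" using q by (simp add: s_def)
  have ln\<rho>: "0 < - ln \<rho>" using \<rho> by simp
  have b: "0 < b" using q by (simp add: b_def)
  have c: "0 \<le> c" unfolding c_def using g r by simp
  have "0 < C" unfolding C_def using s mult_nonneg_nonneg[OF c less_imp_le[OF ln\<rho>]] b by linarith
  moreover have "exp (- (C * (real a * ln (real a) ^ 3))) \<le>
       (\<Sum>w\<in>words_upto n. \<bar>trace_law q x w - trace_law q y w\<bar>)"
    if a: "2 \<le> a" "n \<le> a ^ 5" and xy: "length x = n" "length y = n" "x \<noteq> y" for a n x y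
  proof -
    define t where "t = (\<Sum>w\<in>words_upto n. \<bar>trace_law q x w - trace_law q y w\<bar>)"
    define l where "l = ln (real a)"
    define Y where "Y = real a * l ^ 3"
    define N where "N = 3 * real a ^ 5"
    define L where "L = ln N"
    define E where "E = 1 + 10 * (8 * a * L\<^sup>2 + 1) * L"
    have ra: "2 \<le> real a" using a by simp
    have "ln 2 \<le> l" unfolding l_def using ra by (subst ln_le_cancel_iff) auto
    then have l: "2 / 3 \<le> l" using ln2_ge_two_thirds by linarith
    have "(2 / 3) ^ 3 \<le> l ^ 3" using l by (intro power_mono) auto
    then have "1 / 4 \<le> l ^ 3" by (simp add: power3_eq_cube)
    then have "real a * (1 / 4) \<le> Y" unfolding Y_def using ra by (intro mult_left_mono) auto
    \<comment> \<open>As \<open>2 \<le> a\<close>, this keeps \<open>Y\<close> away from 0, so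
      additive constants become multiples of \<open>Y\<close>.\<close>
    then have aY: "real a \<le> 4 * Y" by simp
    then have Y1: "1 \<le> 4 * Y" and Y0: "0 \<le> Y" using ra by linarith+
    have "2 ^ 5 \<le> real a ^ 5" using ra by (intro power_mono) auto
    then have N96: "96 \<le> N" by (simp add: N_def)
    have L0: "0 \<le> L" unfolding L_def using N96 by (intro ln_ge_zero) simp
    have L7: "L \<le> 7 * l"
    proof -
      have "3 \<le> real a ^ 2"
        using power_mono[of 2 "real a" 2] ra by simp
      then have "N \<le> real a ^ 2 * real a ^ 5"
        unfolding N_def by (intro mult_right_mono) auto
      then have "N \<le> real a ^ 7" by (simp flip: power_add)
      then have "L \<le> ln (real a ^ 7)" unfolding L_def using N96 ra by (subst ln_le_cancel_iff) auto
      also have "\<dots> = 7 * l" using ra by (simp add: ln_realpow l_def)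
      finally show ?thesis .
    qed
    have aL: "real a * L \<le> 28 * Y"
    proof -
      have "1 / 4 \<le> l\<^sup>2" using power_mono[of "2 / 3" l 2] l by (simp add: power2_eq_square)
      then have "l * (1 / 4) \<le> l * l\<^sup>2" using l by (intro mult_left_mono) auto
      then have "L \<le> 28 * l ^ 3" using L7 by (simp add: power2_eq_square power3_eq_cube)
      then have "real a * L \<le> real a * (28 * l ^ 3)" using ra by (intro mult_left_mono) auto
      then show ?thesis by (simp add: Y_def)
    qed
    have LY: "L \<le> 28 * Y"
    proof -
      have "1 * L \<le> real a * L" using ra L0 by (intro mult_right_mono) auto
      then show ?thesis using aL by simp
    qed
    have EY: "E \<le> 28000 * Y"
    proof -
      have "L ^ 3 \<le> (7 * l) ^ 3" using L7 L0 by (intro power_mono)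
      then have "real a * L ^ 3 \<le> real a * (343 * l ^ 3)"
        using ra by (intro mult_left_mono) (auto simp: power_mult_distrib)
      then have "real a * L ^ 3 \<le> 343 * Y" by (simp add: Y_def)
      moreover have "E = 1 + 80 * (real a * L ^ 3) + 10 * L"
        by (simp add: E_def power2_eq_square power3_eq_cube algebra_simps)
      ultimately show ?thesis using LY Y1 by linarith
    qed
    have ln_le_mult: "ln e \<le> j * L" if "0 < e" "e \<le> N ^ j" for e and j :: nat
    proof -
      have "ln e \<le> ln (N ^ j)" using that N96 by (subst ln_le_cancel_iff) auto
      then show ?thesis using N96 by (simp add: ln_realpow L_def)
    qed
    have NN: "96 * N \<le> N * N" using N96 by (intro mult_right_mono) auto
    have ln2N: "ln (2 * N) \<le> 2 * L"
      using ln_le_mult[of "2 * N" 2] NN N96 by (simp add: power2_eq_square)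
    have lnN1: "ln (N + 1) \<le> 2 * L"
      using ln_le_mult[of "N + 1" 2] NN N96 by (simp add: power2_eq_square)
    have ln8: "ln (8 * (N + 2)\<^sup>2) \<le> 6 * L"
    proof -
      have "8 \<le> N\<^sup>2" "N + 2 \<le> N\<^sup>2" unfolding power2_eq_square using NN N96 by linarith+
      moreover from this(2) have "(N + 2)\<^sup>2 \<le> (N\<^sup>2)\<^sup>2" using N96 by (intro power_mono) auto
      ultimately have "8 * (N + 2)\<^sup>2 \<le> N\<^sup>2 * (N\<^sup>2)\<^sup>2" by (intro mult_mono) auto
      also have "\<dots> = N ^ 6" by (simp flip: power_add power_mult)
      finally show ?thesis using ln_le_mult[of "8 * (N + 2)\<^sup>2" 6] N96 by simp
    qed
    obtain k :: nat where k: "k \<le> (ln (2 * N) + (2 * a + 1) * g + 3 * E + ln (8 * (N + 2)\<^sup>2)) / r + 2"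
      "(1 - q) ^ (2 * a + 1) * \<rho> ^ k \<le> exp (b * a) * (N + 1) ^ (2 * a + 2) * t"
      using trace_law_separation_aux[OF q a xy N_def E_def[unfolded L_def]]
      unfolding g_def r_def \<rho>_def b_def t_def by blast
    have two_a: "real (2 * a + 1) \<le> 12 * Y" using aY ra by simp
    have kY: "real k \<le> c * Y"
    proof -
      have "real (2 * a + 1) * g \<le> 12 * Y * g" using two_a g by (rule mult_right_mono)
      then have "ln (2 * N) + (2 * a + 1) * g + 3 * E + ln (8 * (N + 2)\<^sup>2) \<le> (84224 + 12 * g) * Y"
        using ln2N ln8 LY EY by (simp add: algebra_simps)
      then have "(ln (2 * N) + (2 * a + 1) * g + 3 * E + ln (8 * (N + 2)\<^sup>2)) / r \<le> (84224 + 12 * g) * Y / r"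
        using r by (intro divide_right_mono) auto
      then have "real k \<le> (84224 + 12 * g) * Y / r + 8 * Y" using k(1) Y1 by linarith
      then show ?thesis by (simp add: c_def algebra_simps)
    qed
    have e1: "exp (- (12 * s * Y)) \<le> (1 - q) ^ (2 * a + 1)"
    proof -
      have "real (2 * a + 1) * s \<le> 12 * Y * s" using two_a s by (intro mult_right_mono) auto
      then have "exp (- (12 * s * Y)) \<le> exp (real (2 * a + 1) * ln (1 - q))"
        by (simp add: s_def algebra_simps)
      also have "\<dots> = (1 - q) ^ (2 * a + 1)" unfolding exp_of_nat_mult using q by simp
      finally show ?thesis .
    qed
    have e2: "exp (- (c * (- ln \<rho>) * Y)) \<le> \<rho> ^ k"
    proof -
      have "real k * (- ln \<rho>) \<le> c * Y * (- ln \<rho>)" using kY ln\<rho> by (intro mult_right_mono) auto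
      then have "exp (- (c * (- ln \<rho>) * Y)) \<le> exp (real k * ln \<rho>)" by (simp add: algebra_simps)
      also have "\<dots> = \<rho> ^ k" unfolding exp_of_nat_mult using \<rho> by simp
      finally show ?thesis .
    qed
    have e3: "exp (b * a) \<le> exp (4 * b * Y)"
      using mult_left_mono[OF aY, of b] b by simp
    have e4: "(N + 1) ^ (2 * a + 2) \<le> exp (168 * Y)"
    proof -
      have "real (2 * a + 2) * ln (N + 1) \<le> (3 * a) * (2 * L)"
        using lnN1 ra N96 L0 by (intro mult_mono) auto
      also have "\<dots> = 6 * (real a * L)" by simp
      also have "\<dots> \<le> 168 * Y" using aL by linarith
      finally have "exp (real (2 * a + 2) * ln (N + 1)) \<le> exp (168 * Y)" by simp
      moreover have "exp (real (2 * a + 2) * ln (N + 1)) = (N + 1) ^ (2 * a + 2)"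
        unfolding exp_of_nat_mult using N96 by simp
      ultimately show ?thesis by (simp only:)
    qed
    have t0: "0 \<le> t" unfolding t_def by (intro sum_nonneg) auto
    have "exp (- (12 * s * Y)) * exp (- (c * (- ln \<rho>) * Y)) \<le> (1 - q) ^ (2 * a + 1) * \<rho> ^ k"
      using e1 e2 q \<rho> by (intro mult_mono) auto
    also have "\<dots> \<le> exp (b * a) * (N + 1) ^ (2 * a + 2) * t" by (rule k(2))
    also have "\<dots> \<le> exp (4 * b * Y) * exp (168 * Y) * t"
      using e3 e4 t0 N96 by (intro mult_right_mono mult_mono) auto
    finally have "exp (- (12 * s * Y)) * exp (- (c * (- ln \<rho>) * Y)) *
         exp (- (4 * b * Y)) * exp (- (168 * Y)) \<le>
       exp (4 * b * Y) * exp (168 * Y) * t * exp (- (4 * b * Y)) * exp (- (168 * Y))"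
      by (intro mult_right_mono) auto
    also have "\<dots> = t" by (simp add: exp_minus field_simps)
    also have "exp (- (12 * s * Y)) * exp (- (c * (- ln \<rho>) * Y)) *
         exp (- (4 * b * Y)) * exp (- (168 * Y)) = exp (- (C * Y))"
      unfolding C_def by (simp add: algebra_simps flip: exp_add)
    finally show ?thesis by (simp add: t_def Y_def l_def)
  qed
  ultimately show ?thesis by blast
qed

section \<open>Rounding and the number of traces\<close>

lemma nat_ceiling_root5:
  fixes n :: nat
  assumes "2 \<le> n"
  defines "a \<equiv> nat \<lceil>real n powr (1 / 5)\<rceil>"
  shows "2 \<le> a" "n \<le> a ^ 5" "real a * ln a ^ 3 \<le> 64 * (real n powr (1 / 5) * ln n ^ 5)"
proof -
  define x where "x = real n powr (1 / 5)"
  have "1 powr (1 / 5) < real n powr (1 / 5)" using assms by (intro powr_less_mono2) auto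
  then have x: "1 < x" by (simp add: x_def)
  then have a: "x \<le> a" "a \<le> 2 * x" "2 \<le> a" unfolding a_def x_def[symmetric] by linarith+
  show "2 \<le> a" by (rule a(3))
  have "real n = x ^ 5" using assms by (simp add: x_def powr_powr flip: powr_numeral)
  also have "\<dots> \<le> real a ^ 5" using a x by (intro power_mono) auto
  finally show "n \<le> a ^ 5" by (metis of_nat_le_iff of_nat_power)
  define l where "l = ln (real n)"
  have "ln 2 \<le> l" unfolding l_def using assms by (subst ln_le_cancel_iff) auto
  then have l: "1 / 2 \<le> l" "ln 2 \<le> l" using ln2_ge_two_thirds by linarith+
  have "ln a \<le> ln (2 * x)" using a x by (subst ln_le_cancel_iff) auto
  also have "\<dots> = ln 2 + l / 5" using x assms by (simp add: ln_mult ln_powr l_def x_def)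
  also have "\<dots> \<le> 2 * l" using l by simp
  finally have "ln a ^ 3 \<le> (2 * l) ^ 3" using a by (intro power_mono) auto
  also have "\<dots> = 8 * (l ^ 3 * 1)" by (simp add: power_mult_distrib)
  \<comment> \<open>\<open>1 \<le> 4 * l\<^sup>2\<close> raises the power of the logarithm from 3 to
    the 5 of the theorem.\<close>
  also have "\<dots> \<le> 8 * (l ^ 3 * (4 * l\<^sup>2))"
    using power_mono[of "1 / 2" l 2] l by (intro mult_left_mono) (auto simp: power2_eq_square)
  also have "\<dots> = 32 * l ^ 5" by (simp add: eval_nat_numeral)
  finally have "real a * ln a ^ 3 \<le> 2 * x * (32 * l ^ 5)" using a x by (intro mult_mono) auto
  then show "real a * ln a ^ 3 \<le> 64 * (real n powr (1 / 5) * ln n ^ 5)" by (simp add: x_def l_def)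
qed

text \<open>It suffices that \<open>8 * (n + D)\<close> is at most the number of traces times the
  squared separation: \<open>exp (- n)\<close> pays for the \<open>2 ^ n\<close> competing strings,
  and \<open>exp (- D)\<close> is at most \<open>\<delta>\<close>.\<close>

lemma enough_traces:
  fixes C \<delta> :: real
  assumes C: "0 < C" and \<delta>: "0 < \<delta>"
  shows "\<exists>C'>0. \<forall>n\<ge>2. 2 ^ n * exp (- real (num_traces C' n) *
     (exp (- (C * (real n powr (1 / 5) * ln n ^ 5))))\<^sup>2 / 8) \<le> \<delta>"
proof -
  define D where "D = max 0 (- ln \<delta>)"
  \<comment> \<open>\<open>2 * C\<close> cancels the squared exponential. Of 48, 32 pays for
    rounding down in \<open>num_traces\<close> and 16 for \<open>n = exp l\<close> with
    \<open>l \<le> 16 * V\<close>. The logarithm covers the constant \<open>8 * (1 + D)\<close>, by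
    \<open>1 \<le> 32 * V\<close>.\<close>
  define C' where "C' = 2 * C + 48 + 32 * ln (8 * (1 + D))"
  have D: "0 \<le> D" "- ln \<delta> \<le> D" by (simp_all add: D_def)
  have lnD: "0 \<le> ln (8 * (1 + D))" using D by (intro ln_ge_zero) simp
  have C': "0 < C'" using C lnD by (simp add: C'_def)
  have "2 ^ n * exp (- real (num_traces C' n) *
     (exp (- (C * (real n powr (1 / 5) * ln n ^ 5))))\<^sup>2 / 8) \<le> \<delta>" if n: "2 \<le> n" for n
  proof -
    define l where "l = ln (real n)"
    define V where "V = real n powr (1 / 5) * l ^ 5"
    define T where "T = real (num_traces C' n)"
    have "ln 2 \<le> l" unfolding l_def using n by (subst ln_le_cancel_iff) auto
    then have l: "1 / 2 \<le> l" using ln2_ge_two_thirds by linarith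
    have "1 powr (1 / 5) \<le> real n powr (1 / 5)" using n by (intro powr_mono2) auto
    then have "1 * l ^ 5 \<le> V" unfolding V_def using l by (intro mult_right_mono) auto
    then have V: "l ^ 5 \<le> V" by simp
    have "(1 / 2) ^ 4 * l \<le> l ^ 4 * l" using l by (intro mult_right_mono power_mono) auto
    then have "l / 16 \<le> l ^ 5" by (simp add: eval_nat_numeral)
    then have lV: "l \<le> 16 * V" and V1: "1 \<le> 32 * V" using V l by linarith+
    have n_exp: "real n = exp l" using n by (simp add: l_def)
    have "8 * (real n + D) \<le> 8 * (real n * (1 + D))"
      using n D mult_right_mono[of 1 "real n" D] by (simp add: algebra_simps)
    also have "\<dots> = exp (l + ln (8 * (1 + D)))"
      using D by (simp add: exp_add n_exp)
    also have "\<dots> \<le> exp (16 * V + 32 * V * ln (8 * (1 + D)))"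
      using lV mult_right_mono[OF V1 lnD] by simp
    also have "\<dots> = exp ((C' - 2 * C - 32) * V)" by (simp add: C'_def algebra_simps)
    finally have big: "8 * (real n + D) \<le> exp ((C' - 2 * C - 32) * V)" .
    have T: "exp ((C' - 32) * V) \<le> T"
    proof -
      have C'V: "1 \<le> C' * V"
      proof -
        have "32 * V \<le> C' * V" using C lnD V1 by (intro mult_right_mono) (auto simp: C'_def)
        then show ?thesis using V1 by linarith
      qed
      have "exp ((C' - 32) * V) \<le> exp (C' * V - 1)" using V1 by (simp add: algebra_simps)
      also have "\<dots> \<le> exp (C' * V) - 1"
      proof -
        have "exp (C' * V) = exp 1 * exp (C' * V - 1)" by (simp flip: exp_add)
        moreover have "2 * exp (C' * V - 1) \<le> exp 1 * exp (C' * V - 1)"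
          using exp_ge_add_one_self[of 1] by (intro mult_right_mono) auto
        moreover have "1 \<le> exp (C' * V - 1)" using C'V by simp
        ultimately show ?thesis by linarith
      qed
      also have "\<dots> \<le> T" unfolding T_def num_traces_def V_def l_def by (simp add: mult.assoc)
      finally show ?thesis .
    qed
    have "8 * (real n + D) \<le> exp ((C' - 32) * V) * exp (- (2 * C * V))"
      using big by (simp add: algebra_simps flip: exp_add)
    also have "\<dots> \<le> T * exp (- (2 * C * V))" using T by (intro mult_right_mono) auto
    also have "exp (- (2 * C * V)) = (exp (- (C * V)))\<^sup>2"
      by (simp add: power2_eq_square flip: exp_add)
    finally have "- T * (exp (- (C * V)))\<^sup>2 / 8 \<le> - (real n + D)" by simp
    then have "exp (- T * (exp (- (C * V)))\<^sup>2 / 8) \<le> exp (- (real n + D))" by simp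
    moreover have "2 ^ n \<le> exp (real n)"
      using power_mono[of 2 "exp 1 :: real" n] exp_ge_add_one_self[of "1 :: real"]
      by (simp flip: exp_of_nat_mult)
    ultimately have "2 ^ n * exp (- T * (exp (- (C * V)))\<^sup>2 / 8) \<le> exp (real n) * exp (- (real n + D))"
      by (intro mult_mono) auto
    also have "\<dots> = exp (- D)" by (simp flip: exp_add)
    also have "\<dots> \<le> exp (ln \<delta>)" using D(2) by simp
    also have "\<dots> = \<delta>" using \<delta> by simp
    finally show ?thesis by (simp add: T_def V_def l_def)
  qed
  then show ?thesis using C' by blast
qed

theorem theorem1:
  fixes q \<delta> :: real
  assumes "0 < q" "q < 1" "\<delta> > 0"
  shows "\<exists>C>0. \<forall>n::nat. n \<ge> 2 \<longrightarrow>
    (\<exists>F :: bool list list \<Rightarrow> bool list.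
       (\<forall>ws\<in>tuples (num_traces C n) n. length (F ws) = n) \<and>
       (\<forall>x :: bool list. length x = n \<longrightarrow> recon_prob q x (num_traces C n) F \<ge> 1 - \<delta>))"
proof -
  obtain C where C: "0 < C" and sep: "\<And>a n x y. 2 \<le> a \<Longrightarrow> n \<le> a ^ 5 \<Longrightarrow> length x = n \<Longrightarrow>
     length y = n \<Longrightarrow> x \<noteq> y \<Longrightarrow> exp (- (C * (real a * ln (real a) ^ 3))) \<le>
       (\<Sum>w\<in>words_upto n. \<bar>trace_law q x w - trace_law q y w\<bar>)"
    using trace_law_separation[OF assms(1,2)] by blast
  \<comment> \<open>The factor 64 comes from \<open>nat_ceiling_root5\<close>, which passes from
    \<open>a\<close> to \<open>n\<close>.\<close>
  obtain C' where C': "0 < C'" and traces: "\<And>n. 2 \<le> n \<Longrightarrow> 2 ^ n * exp (- real (num_traces C' n) *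
     (exp (- (64 * C * (real n powr (1 / 5) * ln n ^ 5))))\<^sup>2 / 8) \<le> \<delta>"
    using enough_traces[of "64 * C" \<delta>] C assms(3) by auto
  have "\<exists>F. (\<forall>ws\<in>tuples (num_traces C' n) n. length (F ws) = n) \<and>
     (\<forall>x. length x = n \<longrightarrow> recon_prob q x (num_traces C' n) F \<ge> 1 - \<delta>)" if n: "2 \<le> n" for n
  proof -
    define \<epsilon> where "\<epsilon> = exp (- (64 * C * (real n powr (1 / 5) * ln n ^ 5)))"
    define a where "a = nat \<lceil>real n powr (1 / 5)\<rceil>"
    note a = nat_ceiling_root5[OF n, folded a_def]
    have "\<epsilon> \<le> (\<Sum>w\<in>words_upto n. \<bar>trace_law q x w - trace_law q y w\<bar>)"
      if "length x = n" "length y = n" "x \<noteq> y" for x y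
    proof -
      have "\<epsilon> \<le> exp (- (C * (real a * ln (real a) ^ 3)))"
        using mult_left_mono[OF a(3), of C] C by (simp add: \<epsilon>_def)
      also have "\<dots> \<le> (\<Sum>w\<in>words_upto n. \<bar>trace_law q x w - trace_law q y w\<bar>)"
        using a(1,2) that by (rule sep)
      finally show ?thesis .
    qed
    with maximum_likelihood_recon[of q \<epsilon> n "num_traces C' n"] assms(1,2)
    obtain F where F: "\<forall>ws. length (F ws) = n"
      "\<And>x. length x = n \<Longrightarrow> 1 - 2 ^ n * exp (- real (num_traces C' n) * \<epsilon>\<^sup>2 / 8) \<le>
         recon_prob q x (num_traces C' n) F"
      by (auto simp: \<epsilon>_def)
    have "1 - \<delta> \<le> recon_prob q x (num_traces C' n) F" if "length x = n" for x
      using F(2)[OF that] traces[OF n] unfolding \<epsilon>_def by linarith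
    then show ?thesis using F(1) by blast
  qed
  then show ?thesis using C' by blast
qed

end
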